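(* Let $\mathbb{K}$ be a field of characteristic $0$, let $n$ be a positive integer, let $V=\mathbb{K}^n$ with standard basis $e_1,\dots,e_n$, and let $$\det\nolimits_n=\sum_{\sigma\in\mathfrak{S}_n}\operatorname{sgn}(\sigma)\,e_{\sigma(1)}\otimes e_{\sigma(2)}\otimes\cdots\otimes e_{\sigma(n)}\in V^{\otimes n}$$ be the determinant tensor. Then its border rank satisfies $$\underline{\mathbf{R}}(\det\nolimits_n)\ \geq\ \frac{n^{n-1}}{(n-1)!}.$$
   Context: $\mathfrak{S}_n$ is the symmetric group on $n$ letters. For finite-dimensional $\mathbb{K}$-vector spaces $V_1,\dots,V_d$ and $T\in V_1\otimes\cdots\otimes V_d$, the tensor rank $\mathbf{R}(T)$ is the minimal $k$ such that $T=\sum_{i=1}^k v_{i,1}\otimes\cdots\otimes v_{i,d}$ with $v_{i,j}\in V_j$. The border rank $\underline{\mathbf{R}}(T)$ is the minimal $k$ such that $T$ lies in the Zariski closure, in $V_1\otimes\cdots\otimes V_d$, of the set of tensors of tensor rank $\le k$. *)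

theory Defs
  imports
    "HOL-Library.Poly_Mapping"
    "HOL-Combinatorics.Permutations"
    "Jordan_Normal_Form.Matrix"
begin

text \<open>
  Tensors in $K^{n_1} \otimes \cdots \otimes K^{n_d}$ are given by their coordinates in the basis
  $e_{i_1} \otimes \cdots \otimes e_{i_d}$. The format is the list \<open>ns = [n_1, ..., n_d]\<close>, indices
  start at 0, and coordinates at positions that are not multi-indices of the format are 0, so
  that equality of tensors is equality of functions.
\<close>

type_synonym 'a tensor = "nat list \<Rightarrow> 'a"

definition tensor_index :: "nat list \<Rightarrow> nat list set" where
  "tensor_index ns = {is. list_all2 (<) is ns}"

definition tensor_space :: "nat list \<Rightarrow> 'a::field tensor set" where
  "tensor_space ns = {T. \<forall>is. is \<notin> tensor_index ns \<longrightarrow> T is = 0}"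

definition pure_tensor :: "'a::field vec list \<Rightarrow> 'a tensor" where
  "pure_tensor vs = (\<lambda>is. if is \<in> tensor_index (map dim_vec vs)
     then \<Prod>j<length vs. (vs ! j) $ (is ! j) else 0)"

definition tensor_rank :: "nat list \<Rightarrow> 'a::field tensor \<Rightarrow> nat" where
  "tensor_rank ns T = (LEAST k. \<exists>v :: nat \<Rightarrow> 'a vec list.
     (\<forall>i<k. list_all2 (\<lambda>u m. u \<in> carrier_vec m) (v i) ns) \<and>
     T = (\<lambda>is. \<Sum>i<k. pure_tensor (v i) is))"

text \<open>
  Polynomials over \<open>'a\<close> in variables of type \<open>'v\<close>: finitely supported maps from monomials to
  coefficients, a monomial being a finitely supported map from variables to exponents.
\<close>

type_synonym ('v, 'a) multi_poly = "('v \<Rightarrow>\<^sub>0 nat) \<Rightarrow>\<^sub>0 'a"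

definition poly_vars :: "('v, 'a::zero) multi_poly \<Rightarrow> 'v set" where
  "poly_vars p = (\<Union>m\<in>Poly_Mapping.keys p. Poly_Mapping.keys m)"

definition poly_eval :: "('v, 'a::comm_semiring_1) multi_poly \<Rightarrow> ('v \<Rightarrow> 'a) \<Rightarrow> 'a" where
  "poly_eval p x = (\<Sum>m\<in>Poly_Mapping.keys p. Poly_Mapping.lookup p m *
     (\<Prod>i\<in>Poly_Mapping.keys m. x i ^ Poly_Mapping.lookup m i))"

definition zariski_closed :: "nat list \<Rightarrow> 'a::field tensor set \<Rightarrow> bool" where
  "zariski_closed ns Z \<longleftrightarrow> (\<exists>P :: (nat list, 'a) multi_poly set.
     (\<forall>p\<in>P. poly_vars p \<subseteq> tensor_index ns) \<and>
     Z = {T \<in> tensor_space ns. \<forall>p\<in>P. poly_eval p T = 0})"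

definition zariski_closure :: "nat list \<Rightarrow> 'a::field tensor set \<Rightarrow> 'a tensor set" where
  "zariski_closure ns S = \<Inter>{Z. zariski_closed ns Z \<and> S \<subseteq> Z}"

definition border_rank :: "nat list \<Rightarrow> 'a::field tensor \<Rightarrow> nat" where
  "border_rank ns T =
     (LEAST k. T \<in> zariski_closure ns {S \<in> tensor_space ns. tensor_rank ns S \<le> k})"

definition det_tensor :: "nat \<Rightarrow> 'a::field tensor" where
  "det_tensor n = (\<lambda>is. \<Sum>\<sigma> | \<sigma> permutes {..<n}.
     of_int (sign \<sigma>) * pure_tensor (map (\<lambda>j. unit_vec n (\<sigma> j)) [0..<n]) is)"

text \<open>Both minima above are attained for formats with at least one factor, since every tensor then is
  a sum of pure tensors. (A tensor of empty format is a scalar, while the only pure one is 1.)\<close>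

lemma finite_tensor_index: "finite (tensor_index ns)"
proof (induction ns)
  case Nil
  show ?case by (simp add: tensor_index_def)
next
  case (Cons m ns)
  have "tensor_index (m # ns) \<subseteq> (\<lambda>(i, is). i # is) ` ({..<m} \<times> tensor_index ns)"
    by (auto simp: tensor_index_def list_all2_Cons2)
  then show ?case
    using Cons by (meson finite_SigmaI finite_imageI finite_lessThan finite_subset)
qed

lemma pure_tensor_Nil: "pure_tensor [] is = (if is = [] then 1 else 0)"
  by (simp add: pure_tensor_def tensor_index_def)

lemma pure_tensor_Cons:
  "pure_tensor (u # vs) is =
     (case is of [] \<Rightarrow> 0 | i # is' \<Rightarrow> if i < dim_vec u then u $ i * pure_tensor vs is' else 0)"
  by (auto simp: pure_tensor_def tensor_index_def prod.lessThan_Suc_shift simp del: prod.lessThan_Suc split: list.split)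

lemma pure_tensor_unit_vecs:
  assumes "ks \<in> tensor_index ns"
  shows "pure_tensor (map2 unit_vec ns ks) is = (if is = ks then 1 else 0)"
proof -
  have "list_all2 (<) ks ns"
    using assms by (simp add: tensor_index_def)
  then show ?thesis
    by (induction arbitrary: "is" rule: list_all2_induct)
      (auto simp: pure_tensor_Nil pure_tensor_Cons split: list.split)
qed

lemma tensor_decomposition_exists:
  fixes T :: "'a::field tensor"
  assumes T: "T \<in> tensor_space ns" and "ns \<noteq> []"
  shows "\<exists>k (v :: nat \<Rightarrow> 'a vec list).
     (\<forall>i<k. list_all2 (\<lambda>u m. u \<in> carrier_vec m) (v i) ns) \<and>
     T = (\<lambda>is. \<Sum>i<k. pure_tensor (v i) is)"
proof -
  obtain m ms where ns: "ns = m # ms"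
    using \<open>ns \<noteq> []\<close> by (cases ns) auto
  obtain h where h: "bij_betw h {..<card (tensor_index ns)} (tensor_index ns)"
    using ex_bij_betw_nat_finite[OF finite_tensor_index] by (auto simp: atLeast0LessThan)
  define w where "w ks = (T ks \<cdot>\<^sub>v unit_vec m (hd ks)) # map2 unit_vec ms (tl ks)" for ks
  have carrier: "list_all2 (\<lambda>u m. u \<in> carrier_vec m) (w ks) ns" if "ks \<in> tensor_index ns" for ks
    using that by (auto simp: w_def ns tensor_index_def list_all2_Cons2)
      (auto simp: list_all2_conv_all_nth)
  have w: "pure_tensor (w ks) is = (if ks = is then T ks else 0)" if ks: "ks \<in> tensor_index ns" for ks "is"
  proof -
    obtain k ks' where "ks = k # ks'" "k < m" "ks' \<in> tensor_index ms"
      using ks by (auto simp: ns tensor_index_def list_all2_Cons2)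
    then show ?thesis
      by (auto simp: w_def pure_tensor_Cons pure_tensor_unit_vecs split: list.split)
  qed
  have "T is = (\<Sum>i<card (tensor_index ns). pure_tensor (w (h i)) is)" for "is"
  proof -
    have "(\<Sum>i<card (tensor_index ns). pure_tensor (w (h i)) is)
        = (\<Sum>ks\<in>tensor_index ns. pure_tensor (w ks) is)"
      by (rule sum.reindex_bij_betw[OF h])
    also have "\<dots> = (\<Sum>ks\<in>tensor_index ns. if ks = is then T ks else 0)"
      by (simp add: w)
    also have "\<dots> = T is"
      using T by (auto simp: finite_tensor_index tensor_space_def)
    finally show ?thesis by simp
  qed
  moreover have "\<forall>i<card (tensor_index ns). list_all2 (\<lambda>u m. u \<in> carrier_vec m) (w (h i)) ns"
    using carrier bij_betwE[OF h] by auto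
  ultimately show ?thesis
    by (intro exI[of _ "card (tensor_index ns)"] exI[of _ "\<lambda>i. w (h i)"]) auto
qed

lemma det_tensor_in_tensor_space: "det_tensor n \<in> tensor_space (replicate n n)"
proof -
  have "map dim_vec (map (\<lambda>j. unit_vec n (\<sigma> j) :: 'a vec) [0..<n]) = replicate n n" for \<sigma>
    by (simp add: map_replicate_const comp_def)
  then show ?thesis
    by (auto simp: tensor_space_def det_tensor_def pure_tensor_def intro!: sum.neutral)
qed

end

theory Submission
  imports Defs "HOL-Library.Function_Algebras" "HOL-Library.Nat_Bijection"
    "Jordan_Normal_Form.Determinant"
begin

text \<open>
  Let $v \in V$ act on $\Lambda^k V$ by exterior multiplication; for $v \neq 0$ this has rank
  $\binom{n-1}{k}$. Letting the factor number $k = 0, \dots, n-1$ of a tensor act on $\Lambda^k V$ turns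
  $T \in V^{\otimes n}$ into a linear map
  $\Phi(T) : \bigotimes_k \Lambda^k V \to \bigotimes_k \Lambda^{k+1} V$ between spaces of the same
  dimension $\prod_k \binom{n}{k}$, and $\Phi$ of a tensor of rank $\le r$ has rank at most
  $r \prod_k \binom{n-1}{k}$. If $\Phi(\det_n)$ is invertible, non-vanishing of the single polynomial
  $\det \Phi$ gives $r \ge \prod_k \binom{n}{k} / \binom{n-1}{k} = n^n / n!$.

  For invertibility, realize all the $\Lambda^k V$ in one fermionic Fock space with a column of $n$ modes
  for each tensor factor. The polarization operators $E_{kl} = \sum_i a^\dagger_{ik} a_{il}$
  generate a copy of $\mathfrak{gl}_n$. Let $l = n-1$ and let $P_0$ create all modes of column $l$. Up to sign,
  $\Phi(\det_n)$ is the iterated commutator $P_{n-1}$, where $P_{j+1} = [E_{jl}, P_j]$.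
  On a vector $\omega$ of degree $j+1$ in column $l$ we have $P_j \omega = 0$, since it would have degree
  $n+1$ in that column; so $P_{j+1} \omega = - P_j E_{jl} \omega$. If $\omega$ has degree $j$ in column $j$, then
  it has weight $-1$ for the $\mathfrak{sl}_2$-triple of $E_{jl}$, and $E_{jl}$ is injective on it.
  By induction all $P_j$ are injective on the relevant degrees.
\<close>

subsection \<open>Polynomial functions and singular linear systems\<close>

lemma poly_eval_superset:
  assumes "finite A" "Poly_Mapping.keys p \<subseteq> A"
  shows "poly_eval p x = (\<Sum>m\<in>A. Poly_Mapping.lookup p m *
     (\<Prod>i\<in>Poly_Mapping.keys m. x i ^ Poly_Mapping.lookup m i))"
  unfolding poly_eval_def using assms
  by (intro sum.mono_neutral_left) (auto simp: in_keys_iff)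

lemma poly_eval_add: "poly_eval (p + q) x = poly_eval p x + poly_eval q x"
proof -
  let ?A = "Poly_Mapping.keys p \<union> Poly_Mapping.keys q"
  show ?thesis
    using poly_eval_superset[of ?A p x] poly_eval_superset[of ?A q x]
      poly_eval_superset[of ?A "p + q" x] keys_add[of p q]
    by (simp add: lookup_add distrib_right sum.distrib)
qed

lemma poly_eval_single:
  "poly_eval (Poly_Mapping.single m c) x = c * (\<Prod>i\<in>Poly_Mapping.keys m. x i ^ Poly_Mapping.lookup m i)"
  by (cases "c = 0") (auto simp: poly_eval_def)

text \<open>Closure under sums and products is proved for polynomial functions instead of
  polynomials. The set of variables is tracked because a Zariski closed set is cut out by
  polynomials in the variables of the format.\<close>

definition poly_fun :: "'v set \<Rightarrow> (('v \<Rightarrow> 'a::comm_semiring_1) \<Rightarrow> 'a) \<Rightarrow> bool" where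
  "poly_fun X f \<longleftrightarrow> (\<exists>p. poly_vars p \<subseteq> X \<and> poly_eval p = f)"

lemma poly_fun_add:
  assumes "poly_fun X f" "poly_fun X g"
  shows "poly_fun X (\<lambda>x. f x + g x)"
proof -
  obtain p q where "poly_vars p \<subseteq> X" "poly_eval p = f" "poly_vars q \<subseteq> X" "poly_eval q = g"
    using assms by (auto simp: poly_fun_def)
  moreover have "poly_vars (p + q) \<subseteq> poly_vars p \<union> poly_vars q"
    using keys_add[of p q] by (auto simp: poly_vars_def)
  ultimately show ?thesis
    unfolding poly_fun_def by (intro exI[of _ "p + q"]) (auto simp: poly_eval_add)
qed

lemma poly_fun_const: "poly_fun X (\<lambda>x. c)"
  unfolding poly_fun_def
  by (intro exI[of _ "Poly_Mapping.single 0 c"])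
    (auto simp: poly_vars_def poly_eval_single fun_eq_iff split: if_splits)

lemma poly_fun_sum: "(\<And>i. i \<in> I \<Longrightarrow> poly_fun X (f i)) \<Longrightarrow> poly_fun X (\<lambda>x. \<Sum>i\<in>I. f i x)"
  by (induction I rule: infinite_finite_induct) (auto intro: poly_fun_add poly_fun_const)

lemma poly_fun_monomial:
  "Poly_Mapping.keys m \<subseteq> X \<Longrightarrow>
    poly_fun X (\<lambda>x. c * (\<Prod>i\<in>Poly_Mapping.keys m. x i ^ Poly_Mapping.lookup m i))"
  unfolding poly_fun_def
  by (intro exI[of _ "Poly_Mapping.single m c"])
    (auto simp: poly_vars_def poly_eval_single fun_eq_iff split: if_splits)

lemma monomial_eval_add:
  "(\<Prod>i\<in>Poly_Mapping.keys (m + m'). (x i::'a::comm_semiring_1) ^ Poly_Mapping.lookup (m + m') i) =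
   (\<Prod>i\<in>Poly_Mapping.keys m. x i ^ Poly_Mapping.lookup m i) *
   (\<Prod>i\<in>Poly_Mapping.keys m'. x i ^ Poly_Mapping.lookup m' i)"
proof -
  let ?A = "Poly_Mapping.keys m \<union> Poly_Mapping.keys m'"
  have "(\<Prod>i\<in>Poly_Mapping.keys u. x i ^ Poly_Mapping.lookup u i) = (\<Prod>i\<in>?A. x i ^ Poly_Mapping.lookup u i)"
    if "Poly_Mapping.keys u \<subseteq> ?A" for u
    using that by (intro prod.mono_neutral_left) (auto simp: in_keys_iff)
  from this[of m] this[of m'] this[of "m + m'"] show ?thesis
    using keys_add[of m m'] by (simp add: lookup_add power_add prod.distrib)
qed

lemma poly_fun_mult:
  assumes "poly_fun X f" "poly_fun X g"
  shows "poly_fun X (\<lambda>x. f x * g x)"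
proof -
  obtain p q where p: "poly_vars p \<subseteq> X" "poly_eval p = f" and q: "poly_vars q \<subseteq> X" "poly_eval q = g"
    using assms by (auto simp: poly_fun_def)
  have "poly_fun X (\<lambda>x. \<Sum>m\<in>Poly_Mapping.keys p. \<Sum>m'\<in>Poly_Mapping.keys q.
     (Poly_Mapping.lookup p m * Poly_Mapping.lookup q m') *
     (\<Prod>i\<in>Poly_Mapping.keys (m + m'). x i ^ Poly_Mapping.lookup (m + m') i))"
  proof (rule poly_fun_sum, rule poly_fun_sum, rule poly_fun_monomial)
    fix m m' assume "m \<in> Poly_Mapping.keys p" "m' \<in> Poly_Mapping.keys q"
    then have "Poly_Mapping.keys m \<subseteq> X" "Poly_Mapping.keys m' \<subseteq> X"
      using p(1) q(1) by (auto simp: poly_vars_def)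
    then show "Poly_Mapping.keys (m + m') \<subseteq> X"
      using keys_add[of m m'] by blast
  qed
  also have "(\<lambda>x. \<Sum>m\<in>Poly_Mapping.keys p. \<Sum>m'\<in>Poly_Mapping.keys q.
     (Poly_Mapping.lookup p m * Poly_Mapping.lookup q m') *
     (\<Prod>i\<in>Poly_Mapping.keys (m + m'). x i ^ Poly_Mapping.lookup (m + m') i)) = (\<lambda>x. f x * g x)"
    unfolding p(2)[symmetric] q(2)[symmetric] poly_eval_def monomial_eval_add
    by (simp add: sum_product mult_ac)
  finally show ?thesis .
qed

lemma poly_fun_prod: "(\<And>i. i \<in> I \<Longrightarrow> poly_fun X (f i)) \<Longrightarrow> poly_fun X (\<lambda>x. \<Prod>i\<in>I. f i x)"
  by (induction I rule: infinite_finite_induct) (auto intro: poly_fun_mult poly_fun_const)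

lemma poly_fun_var:
  assumes "v \<in> X"
  shows "poly_fun X (\<lambda>x. x v :: 'a::comm_semiring_1)"
  using poly_fun_monomial[of "Poly_Mapping.single v 1" X "1::'a"] assms by simp

text \<open>The zero locus of the single polynomial behind \<open>f\<close> is a closed set
  containing \<open>S\<close>, so it contains the closure.\<close>

lemma zariski_closure_vanish:
  assumes "poly_fun (tensor_index ns) f" "S \<subseteq> tensor_space ns" "\<And>T. T \<in> S \<Longrightarrow> f T = 0"
    and "T \<in> zariski_closure ns S"
  shows "f T = 0"
proof -
  obtain p where p: "poly_vars p \<subseteq> tensor_index ns" "poly_eval p = f"
    using assms(1) by (auto simp: poly_fun_def)
  let ?Z = "{T \<in> tensor_space ns. \<forall>p\<in>{p}. poly_eval p T = 0}"
  have "zariski_closed ns ?Z"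
    unfolding zariski_closed_def using p(1) by blast
  moreover have "S \<subseteq> ?Z"
    using assms(2,3) p(2) by auto
  ultimately have "T \<in> ?Z"
    using assms(4) unfolding zariski_closure_def by blast
  then show ?thesis
    using p(2) by simp
qed

section \<open>Determinants and kernels of linear systems over arbitrary finite index sets\<close>

lemma kernel_iff_det:
  fixes M :: "'b \<Rightarrow> 'c \<Rightarrow> 'a::field"
  assumes h: "bij_betw h {..<N} X" and g: "bij_betw g {..<N} Y"
  shows "det (mat N N (\<lambda>(i, j). M (g i) (h j))) = 0 \<longleftrightarrow>
    (\<exists>x. (\<exists>a\<in>X. x a \<noteq> 0) \<and> (\<forall>b\<in>Y. (\<Sum>a\<in>X. M b a * x a) = 0))"
    (is "det ?A = 0 \<longleftrightarrow> ?R")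
proof -
  have A: "?A \<in> carrier_mat N N" by simp
  have row: "(?A *\<^sub>v v) $ i = (\<Sum>j<N. M (g i) (h j) * v $ j)" if "i < N" "v \<in> carrier_vec N" for i v
    using that by (auto simp: scalar_prod_def atLeast0LessThan)
  have "det ?A = 0 \<longleftrightarrow> (\<exists>v. v \<in> carrier_vec N \<and> v \<noteq> 0\<^sub>v N \<and> ?A *\<^sub>v v = 0\<^sub>v N)"
    by (rule det_0_iff_vec_prod_zero[OF A])
  also have "\<dots> \<longleftrightarrow> ?R"
  proof
    assume "\<exists>v. v \<in> carrier_vec N \<and> v \<noteq> 0\<^sub>v N \<and> ?A *\<^sub>v v = 0\<^sub>v N"
    then obtain v where v: "v \<in> carrier_vec N" "v \<noteq> 0\<^sub>v N" "?A *\<^sub>v v = 0\<^sub>v N" by blast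
    define x where "x a = v $ the_inv_into {..<N} h a" for a
    have xh: "x (h j) = v $ j" if "j < N" for j
      using that h by (simp add: x_def bij_betw_def the_inv_into_f_f)
    have "\<exists>a\<in>X. x a \<noteq> 0"
    proof -
      obtain j where "j < N" "v $ j \<noteq> 0"
        using v(1,2) by (auto simp: vec_eq_iff)
      then show ?thesis
        using xh h by (intro bexI[of _ "h j"]) (auto dest: bij_betwE)
    qed
    moreover have "(\<Sum>a\<in>X. M b a * x a) = 0" if "b \<in> Y" for b
    proof -
      obtain i where i: "i < N" "b = g i"
        using \<open>b \<in> Y\<close> bij_betw_imp_surj_on[OF g] by blast
      have "(\<Sum>a\<in>X. M b a * x a) = (\<Sum>j<N. M (g i) (h j) * x (h j))"
        unfolding i by (rule sum.reindex_bij_betw[OF h, symmetric])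
      also have "\<dots> = (?A *\<^sub>v v) $ i"
        using row[OF i(1) v(1)] by (simp add: xh)
      finally show ?thesis
        using v(3) i by simp
    qed
    ultimately show ?R by blast
  next
    assume ?R
    then obtain x where x: "\<exists>a\<in>X. x a \<noteq> 0" "\<And>b. b \<in> Y \<Longrightarrow> (\<Sum>a\<in>X. M b a * x a) = 0" by blast
    define v where "v = vec N (x \<circ> h)"
    have v: "v \<in> carrier_vec N" by (simp add: v_def)
    moreover have "v \<noteq> 0\<^sub>v N"
    proof -
      obtain j where "j < N" "x (h j) \<noteq> 0"
        using x(1) h by (auto simp: bij_betw_def)
      then show ?thesis
        by (auto simp: v_def vec_eq_iff)
    qed
    moreover have "?A *\<^sub>v v = 0\<^sub>v N"
    proof (rule eq_vecI)
      fix i assume "i < dim_vec (0\<^sub>v N :: 'a vec)"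
      then have i: "i < N" by simp
      have "(?A *\<^sub>v v) $ i = (\<Sum>j<N. M (g i) (h j) * x (h j))"
        using row[OF i v] by (simp add: v_def)
      also have "\<dots> = (\<Sum>a\<in>X. M (g i) a * x a)"
        by (rule sum.reindex_bij_betw[OF h])
      also have "\<dots> = 0"
        using g i by (intro x(2)) (auto dest: bij_betwE)
      finally show "(?A *\<^sub>v v) $ i = 0\<^sub>v N $ i" using i by simp
    qed simp
    ultimately show "\<exists>v. v \<in> carrier_vec N \<and> v \<noteq> 0\<^sub>v N \<and> ?A *\<^sub>v v = 0\<^sub>v N" by blast
  qed
  finally show ?thesis .
qed

text \<open>Padding with zero rows makes the system square with determinant 0, and
  \<open>kernel_iff_det\<close> then supplies a non-zero solution.\<close>

lemma underdetermined_system: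
  fixes M :: "'b \<Rightarrow> 'c \<Rightarrow> 'a::field"
  assumes "finite X" "finite Y" "card Y < card X"
  shows "\<exists>x. (\<exists>a\<in>X. x a \<noteq> 0) \<and> (\<forall>b\<in>Y. (\<Sum>a\<in>X. M b a * x a) = 0)"
proof -
  obtain h where h: "bij_betw h {..<card X} X"
    using ex_bij_betw_nat_finite[OF assms(1)] by (auto simp: atLeast0LessThan)
  obtain g where g: "bij_betw g {..<card Y} Y"
    using ex_bij_betw_nat_finite[OF assms(2)] by (auto simp: atLeast0LessThan)
  define M' where "M' i a = (if i < card Y then M (g i) a else 0)" for i a
  let ?N = "card X"
  let ?A = "mat ?N ?N (\<lambda>(i, j). M' (id i) (h j))"
  have "det ?A = 0"
  proof -
    \<comment> \<open>Row \<open>card Y\<close> is one of the padded rows because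
      \<open>card Y < card X\<close>, so every term of the Leibniz expansion has a zero
      factor.\<close>
    have "(\<Prod>i = 0..<?N. ?A $$ (i, p i)) = 0" if "p permutes {0..<?N}" for p
    proof (rule prod_zero)
      show "\<exists>i\<in>{0..<?N}. ?A $$ (i, p i) = 0"
        using assms(3) permutes_in_image[OF that, of "card Y"]
        by (intro bexI[of _ "card Y"]) (auto simp: M'_def)
    qed simp
    then show ?thesis
      by (subst det_def'[of _ ?N]) (auto intro!: sum.neutral)
  qed
  then obtain x where x: "\<exists>a\<in>X. x a \<noteq> 0" "\<forall>i<?N. (\<Sum>a\<in>X. M' i a * x a) = 0"
    using kernel_iff_det[OF h, of id "{..<?N}" M'] by (auto simp del: id_apply)
  have "(\<Sum>a\<in>X. M b a * x a) = 0" if "b \<in> Y" for b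
  proof -
    obtain i where "i < card Y" "b = g i"
      using \<open>b \<in> Y\<close> bij_betw_imp_surj_on[OF g] by blast
    then show ?thesis
      using x(2)[rule_format, of i] assms(3) by (simp add: M'_def)
  qed
  with x(1) show ?thesis by blast
qed

text \<open>The matrix entries are linear forms in the coordinates of \<open>T\<close>, so the
  determinant is a polynomial in \<open>T\<close>. Singularity is the vanishing of this polynomial
  and therefore passes to the closure.\<close>

lemma zariski_closure_singular:
  fixes c :: "nat list \<Rightarrow> 'b \<Rightarrow> 'c \<Rightarrow> 'a::field"
  assumes "finite X" "finite Y" "card X = card Y" "\<A> \<subseteq> tensor_space ns"
    and sing: "\<And>T. T \<in> \<A> \<Longrightarrow> \<exists>x. (\<exists>a\<in>X. x a \<noteq> 0) \<and>
      (\<forall>b\<in>Y. (\<Sum>a\<in>X. (\<Sum>is\<in>tensor_index ns. T is * c is b a) * x a) = 0)"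
    and T: "T \<in> zariski_closure ns \<A>"
  shows "\<exists>x. (\<exists>a\<in>X. x a \<noteq> 0) \<and>
      (\<forall>b\<in>Y. (\<Sum>a\<in>X. (\<Sum>is\<in>tensor_index ns. T is * c is b a) * x a) = 0)"
proof -
  define N where "N = card X"
  obtain h where h: "bij_betw h {..<N} X"
    using ex_bij_betw_nat_finite[OF assms(1)] by (auto simp: atLeast0LessThan N_def)
  obtain g where g: "bij_betw g {..<N} Y"
    using ex_bij_betw_nat_finite[OF assms(2)] assms(3) by (auto simp: atLeast0LessThan N_def)
  define M where "M T b a = (\<Sum>is\<in>tensor_index ns. T is * c is b a)" for T b a
  note iff = kernel_iff_det[OF h g]
  have "poly_fun (tensor_index ns) (\<lambda>T. det (mat N N (\<lambda>(i, j). M T (g i) (h j))))"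
  proof -
    have entry: "poly_fun (tensor_index ns) (\<lambda>T. M T b a)" for b a
      unfolding M_def by (rule poly_fun_sum, rule poly_fun_mult, rule poly_fun_var, assumption, rule poly_fun_const)
    have "poly_fun (tensor_index ns) (\<lambda>T. \<Sum>p\<in>{p. p permutes {0..<N}}.
        signof p * (\<Prod>i = 0..<N. M T (g i) (h (p i))))"
      by (rule poly_fun_sum, rule poly_fun_mult, rule poly_fun_const, rule poly_fun_prod, rule entry)
    moreover have "det (mat N N (\<lambda>(i, j). M T (g i) (h j))) =
      (\<Sum>p\<in>{p. p permutes {0..<N}}. signof p * (\<Prod>i = 0..<N. M T (g i) (h (p i))))" for T
      by (subst det_def'[of _ N]) (auto intro!: sum.cong prod.cong simp: permutes_in_image)
    ultimately show ?thesis
      by simp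
  qed
  then have "det (mat N N (\<lambda>(i, j). M T (g i) (h j))) = 0"
  proof (rule zariski_closure_vanish[OF _ assms(4) _ T])
    fix T assume "T \<in> \<A>"
    from sing[OF this] show "det (mat N N (\<lambda>(i, j). M T (g i) (h j))) = 0"
      by (intro iff[THEN iffD2]) (simp only: M_def)
  qed
  then show ?thesis
    by (drule_tac iff[THEN iffD1]) (simp only: M_def)
qed

subsection \<open>Fermionic Fock space\<close>

type_synonym 'a fock = "nat set \<Rightarrow> 'a"

text \<open>Jordan--Wigner signs. They are also meaningful for infinite sets of modes, since only the finitely
  many modes below \<open>q\<close> count, so that the anticommutation relations hold on all functions.\<close>

definition jw_sign :: "nat \<Rightarrow> nat set \<Rightarrow> 'a::comm_ring_1" where
  "jw_sign q S = (- 1) ^ card {r \<in> S. r < q}"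

text \<open>For finite \<open>S\<close>, read \<open>f S\<close> as the coefficient of the wedge of
  the modes in \<open>S\<close> in increasing order. Then \<open>cre q\<close> is left exterior
  multiplication by mode \<open>q\<close>, and \<open>ann q\<close> is contraction with the dual
  vector.\<close>

definition cre :: "nat \<Rightarrow> 'a::comm_ring_1 fock \<Rightarrow> 'a fock" where
  "cre q f = (\<lambda>S. if q \<in> S then jw_sign q S * f (S - {q}) else 0)"

definition ann :: "nat \<Rightarrow> 'a::comm_ring_1 fock \<Rightarrow> 'a fock" where
  "ann q f = (\<lambda>S. if q \<in> S then 0 else jw_sign q S * f (insert q S))"

definition scale :: "'a::comm_ring_1 \<Rightarrow> 'a fock \<Rightarrow> 'a fock" where
  "scale c f = (\<lambda>S. c * f S)"

lemma sum_fock_apply: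
  fixes F :: "'b \<Rightarrow> 'a::comm_monoid_add fock"
  shows "(\<Sum>i\<in>I. F i) S = (\<Sum>i\<in>I. F i S)"
  by (induction I rule: infinite_finite_induct) auto

lemma jw_sign_insert:
  "p \<notin> S \<Longrightarrow> jw_sign q (insert p S) = (if p < q then - jw_sign q S else jw_sign q S)"
proof -
  assume p: "p \<notin> S"
  have "{r \<in> insert p S. r < q} = (if p < q then insert p {r \<in> S. r < q} else {r \<in> S. r < q})"
    by auto
  moreover have "finite {r \<in> S. r < q}"
    by (rule finite_subset[of _ "{..<q}"]) auto
  ultimately show ?thesis
    using p by (simp add: jw_sign_def)
qed

lemma jw_sign_remove:
  assumes "p \<in> S"
  shows "jw_sign q (S - {p}) = (if p < q then - jw_sign q S else jw_sign q S :: 'a::comm_ring_1)"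
  using jw_sign_insert[of p "S - {p}" q, where 'a = 'a] assms
  by (auto simp: insert_absorb split: if_splits)

lemma jw_sign_square [simp]: "jw_sign q S * jw_sign q S = 1"
  by (simp add: jw_sign_def flip: power_mult_distrib)

lemma jw_sign_square' [simp]: "jw_sign q S * (jw_sign q S * x) = x"
  by (simp flip: mult.assoc)

lemma jw_sign_nonzero [simp]: "jw_sign q S \<noteq> (0::'a::idom)"
  by (simp add: jw_sign_def)

lemma cre_0 [simp]: "cre q 0 = 0" and ann_0 [simp]: "ann q 0 = 0"
  by (auto simp: cre_def ann_def fun_eq_iff)

lemma cre_add: "cre q (f + g) = cre q f + cre q g" and ann_add: "ann q (f + g) = ann q f + ann q g"
  by (auto simp: cre_def ann_def fun_eq_iff algebra_simps)

lemma cre_uminus: "cre q (- f) = - cre q f"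
  by (auto simp: cre_def fun_eq_iff)

lemma cre_diff: "cre q (f - g) = cre q f - cre q g"
  by (auto simp: cre_def fun_eq_iff algebra_simps)

lemma cre_scale: "cre q (scale c f) = scale c (cre q f)"
  and ann_scale: "ann q (scale c f) = scale c (ann q f)"
  by (auto simp: cre_def ann_def scale_def fun_eq_iff)

lemma cre_sum: "cre q (\<Sum>i\<in>I. F i) = (\<Sum>i\<in>I. cre q (F i))"
  by (induction I rule: infinite_finite_induct) (simp_all only: sum.infinite sum.empty sum.insert cre_0 cre_add not_False_eq_True)

lemma ann_sum: "ann q (\<Sum>i\<in>I. F i) = (\<Sum>i\<in>I. ann q (F i))"
  by (induction I rule: infinite_finite_induct) (simp_all only: sum.infinite sum.empty sum.insert ann_0 ann_add not_False_eq_True)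

text \<open>For \<open>p \<noteq> q\<close>, removing the smaller mode flips the sign attached to
  the larger one but not conversely, so the two orders differ by one sign. For \<open>p = q\<close>
  both sides vanish.\<close>

lemma cre_cre: "cre p (cre q f) = - cre q (cre p f)"
proof
  fix S
  have "S - {p} - {q} = S - {q} - {p}" by auto
  then show "cre p (cre q f) S = (- cre q (cre p f)) S"
    by (cases p q rule: linorder_cases) (auto simp: cre_def jw_sign_remove mult_ac)
qed

lemma ann_ann: "ann p (ann q f) = - ann q (ann p f)"
proof
  fix S
  show "ann p (ann q f) S = (- ann q (ann p f)) S"
    by (cases p q rule: linorder_cases) (auto simp: ann_def jw_sign_insert mult_ac insert_commute)
qed

lemma ann_cre: "ann p (cre q f) = (if p = q then f else 0) - cre q (ann p f)"
proof
  fix S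
  have "insert p S - {q} = insert p (S - {q})" if "p \<noteq> q" using that by auto
  moreover have "insert p (S - {p}) = S" if "p \<in> S" using that by auto
  ultimately show "ann p (cre q f) S = ((if p = q then f else 0) - cre q (ann p f)) S"
    by (cases p q rule: linorder_cases)
      (auto simp: ann_def cre_def jw_sign_insert jw_sign_remove mult_ac)
qed

lemma cre_ann_same: "cre q (ann q f) S = (if q \<in> S then f S else 0)"
  by (auto simp: cre_def ann_def jw_sign_remove insert_absorb)

text \<open>Mode \<open>(i, k)\<close> stands for the basis vector \<open>e\<^sub>i\<close> in tensor factor \<open>k\<close>.\<close>

abbreviation mode :: "nat \<Rightarrow> nat \<Rightarrow> nat" where
  "mode i k \<equiv> prod_encode (i, k)"

definition occupied :: "nat \<Rightarrow> nat \<Rightarrow> nat set \<Rightarrow> nat set" where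
  "occupied n k S = {i. i < n \<and> mode i k \<in> S}"

text \<open>This is the exterior degree in tensor factor \<open>k\<close>. The other columns are
  unconstrained, and 0 has every degree.\<close>

definition homog :: "nat \<Rightarrow> nat \<Rightarrow> nat \<Rightarrow> 'a::zero fock \<Rightarrow> bool" where
  "homog n k d f \<longleftrightarrow> (\<forall>S. f S \<noteq> 0 \<longrightarrow> card (occupied n k S) = d)"

text \<open>The operator \<open>E_kl\<close>: each term moves one particle from column
  \<open>l\<close> to column \<open>k\<close> within its row.\<close>

definition polar :: "nat \<Rightarrow> nat \<Rightarrow> nat \<Rightarrow> 'a::comm_ring_1 fock \<Rightarrow> 'a fock" where
  "polar n k l f = (\<Sum>i<n. cre (mode i k) (ann (mode i l) f))"

lemma finite_occupied [simp]: "finite (occupied n k S)"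
  by (simp add: occupied_def)

lemma card_occupied_le: "card (occupied n k S) \<le> n"
  using card_mono[of "{..<n}" "occupied n k S"] by (auto simp: occupied_def)

lemma homog_0 [simp]: "homog n k d 0"
  by (simp add: homog_def)

lemma homog_gt: "homog n k d f \<Longrightarrow> n < d \<Longrightarrow> f = 0"
proof (rule ext, rule ccontr)
  fix S assume "homog n k d f" "n < d" "f S \<noteq> 0 S"
  then show False
    using card_occupied_le[of n k S] by (simp add: homog_def)
qed

lemma homog_add: "homog n k d f \<Longrightarrow> homog n k d g \<Longrightarrow> homog n k d (f + g)"
  for f :: "'a::monoid_add fock"
  by (auto simp: homog_def) (metis add_0)

lemma homog_sum: "(\<And>i. i \<in> I \<Longrightarrow> homog n k d (F i)) \<Longrightarrow> homog n k d (\<Sum>i\<in>I. F i)"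
  for F :: "'b \<Rightarrow> 'a::comm_monoid_add fock"
  by (induction I rule: infinite_finite_induct) (auto intro: homog_add)

lemma occupied_remove: "occupied n k (S - {mode i k'}) = (if k' = k then occupied n k S - {i} else occupied n k S)"
  and occupied_insert: "occupied n k (insert (mode i k') S) =
    (if k' = k \<and> i < n then insert i (occupied n k S) else occupied n k S)"
  by (auto simp: occupied_def)

lemma mem_occupied: "i < n \<Longrightarrow> i \<in> occupied n k S \<longleftrightarrow> mode i k \<in> S"
  by (simp add: occupied_def)

lemma homog_cre:
  assumes "homog n k d f" "i < n"
  shows "homog n k (Suc d) (cre (mode i k) f)"
  unfolding homog_def
proof (intro allI impI)
  fix S assume "cre (mode i k) f S \<noteq> 0"
  then have S: "mode i k \<in> S" "f (S - {mode i k}) \<noteq> 0"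
    by (auto simp: cre_def split: if_splits)
  then have "card (occupied n k S - {i}) = d"
    using assms by (auto simp: homog_def occupied_remove)
  moreover have "i \<in> occupied n k S"
    using S assms by (simp add: mem_occupied)
  ultimately show "card (occupied n k S) = Suc d"
    by (metis card_Suc_Diff1 finite_occupied)
qed

lemma homog_cre_other: "homog n k d f \<Longrightarrow> k' \<noteq> k \<Longrightarrow> homog n k d (cre (mode i k') f)"
  unfolding homog_def
proof (intro allI impI)
  fix S assume f: "\<forall>S. f S \<noteq> 0 \<longrightarrow> card (occupied n k S) = d" "k' \<noteq> k" and nz: "cre (mode i k') f S \<noteq> 0"
  from nz have "f (S - {mode i k'}) \<noteq> 0"
    by (auto simp: cre_def split: if_splits)
  then show "card (occupied n k S) = d"
    using f occupied_remove[of n k S i k'] by metis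
qed

text \<open>The successor form yields both the degree drop and the vanishing in degree 0, which
  \<open>d - 1\<close> alone does not distinguish.\<close>

lemma card_occupied_ann:
  assumes "ann (mode i k) f S \<noteq> 0" "homog n k d f" "i < n"
  shows "d = Suc (card (occupied n k S))"
proof -
  have S: "mode i k \<notin> S" "f (insert (mode i k) S) \<noteq> 0"
    using assms(1) by (auto simp: ann_def split: if_splits)
  have "i \<notin> occupied n k S"
    using S by (simp add: occupied_def)
  moreover have "card (insert i (occupied n k S)) = d"
    using S assms(2,3) occupied_insert[of n k i k S] unfolding homog_def by metis
  ultimately show ?thesis by simp
qed

lemma homog_ann: "homog n k d f \<Longrightarrow> i < n \<Longrightarrow> homog n k (d - 1) (ann (mode i k) f)"
  unfolding homog_def[of n k "d - 1"] by (auto dest!: card_occupied_ann)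

lemma homog_0_ann: "homog n k 0 f \<Longrightarrow> i < n \<Longrightarrow> ann (mode i k) f = 0"
  by (auto simp: fun_eq_iff dest: card_occupied_ann)

lemma homog_ann_other: "homog n k d f \<Longrightarrow> k' \<noteq> k \<Longrightarrow> homog n k d (ann (mode i k') f)"
  unfolding homog_def
proof (intro allI impI)
  fix S assume f: "\<forall>S. f S \<noteq> 0 \<longrightarrow> card (occupied n k S) = d" "k' \<noteq> k" and nz: "ann (mode i k') f S \<noteq> 0"
  from nz have "f (insert (mode i k') S) \<noteq> 0"
    by (auto simp: ann_def split: if_splits)
  then show "card (occupied n k S) = d"
    using f occupied_insert[of n k i k' S] by metis
qed

section \<open>Polarization operators and their \<open>sl_2\<close>-triples\<close>

lemma polar_0 [simp]: "polar n k l 0 = 0"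
  by (simp only: polar_def cre_0 ann_0 sum.neutral_const)

lemma polar_scale: "polar n k l (scale c f) = scale c (polar n k l f)"
  unfolding polar_def ann_scale cre_scale by (simp add: scale_def fun_eq_iff sum_fock_apply sum_distrib_left)

lemma homog_polar_raise: "homog n k d f \<Longrightarrow> k \<noteq> l \<Longrightarrow> homog n k (Suc d) (polar n k l f)"
  unfolding polar_def by (intro homog_sum homog_cre homog_ann_other) auto

lemma homog_polar_lower: "homog n l d f \<Longrightarrow> k \<noteq> l \<Longrightarrow> homog n l (d - 1) (polar n k l f)"
  unfolding polar_def by (intro homog_sum homog_cre_other homog_ann) auto

lemma homog_polar_other: "homog n j d f \<Longrightarrow> k \<noteq> j \<Longrightarrow> l \<noteq> j \<Longrightarrow> homog n j d (polar n k l f)"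
  unfolding polar_def by (intro homog_sum homog_cre_other homog_ann_other) auto

lemma homog_0_polar: "homog n l 0 f \<Longrightarrow> polar n k l f = 0"
  unfolding polar_def by (intro sum.neutral) (auto simp: homog_0_ann)

lemma polar_same:
  assumes "homog n k d f"
  shows "polar n k k f = scale (of_nat d) f"
proof
  fix S
  have "polar n k k f S = (\<Sum>i<n. if i \<in> occupied n k S then f S else 0)"
    by (simp add: polar_def sum_fock_apply cre_ann_same mem_occupied)
  also have "\<dots> = of_nat (card (occupied n k S)) * f S"
    by (simp flip: sum.inter_filter add: Int_def) (simp add: occupied_def conj_commute)
  also have "\<dots> = scale (of_nat d) f S"
    using assms by (cases "f S = 0") (auto simp: homog_def scale_def)
  finally show "polar n k k f S = scale (of_nat d) f S" .
qed

text \<open>Normal ordering of either product leaves a quadratic term, a number operator, and a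
  quartic term. The quartic terms agree and cancel.\<close>

lemma polar_commutator:
  fixes f :: "'a::comm_ring_1 fock"
  assumes "k \<noteq> l"
  shows "polar n k l (polar n l k f) = polar n l k (polar n k l f) + polar n k k f - polar n l l f"
proof -
  define Q where "Q k l = (\<Sum>i<n. \<Sum>j<n. cre (mode i k) (cre (mode j l) (ann (mode i l) (ann (mode j k) f))))"
    for k l
  have PP: "polar n k l (polar n l k f) = polar n k k f - Q k l" if "k \<noteq> l" for k l
  proof -
    have "polar n k l (polar n l k f) =
      (\<Sum>i<n. \<Sum>j<n. (if i = j then cre (mode i k) (ann (mode j k) f) else 0)
         - cre (mode i k) (cre (mode j l) (ann (mode i l) (ann (mode j k) f))))"
      unfolding polar_def
      by (auto simp: ann_sum cre_sum ann_cre cre_diff intro!: sum.cong)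
    also have "\<dots> = polar n k k f - Q k l"
      by (simp add: sum_subtractf polar_def Q_def)
    finally show ?thesis .
  qed
  \<comment> \<open>Exchanging the two creators and exchanging the two annihilators costs two signs,
    which cancel. Renaming \<open>i\<close> and \<open>j\<close> then exchanges the columns.\<close>
  have "Q k l = Q l k"
  proof -
    have "cre p (cre q (ann r (ann s f))) = cre q (cre p (ann s (ann r f)))" for p q r s
      using cre_cre[of p q "ann r (ann s f)"] ann_ann[of r s f] by (simp add: cre_uminus)
    then show ?thesis
      unfolding Q_def by (subst (2) sum.swap) simp
  qed
  then show ?thesis
    using PP[OF assms] PP[of l k] assms by simp
qed

text \<open>Here \<open>f\<close> is killed by the raising operator \<open>E_kl\<close> and has
  weight \<open>d - (d + 1) = -1\<close>, while a highest weight vector on which powers of the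
  lowering operator \<open>E_lk\<close> eventually vanish cannot have negative weight. The proof
  lowers \<open>f\<close> down to 0 and raises back; characteristic 0 keeps the factors met on the
  way non-zero.\<close>

lemma polar_inj:
  fixes f :: "'a::field_char_0 fock"
  assumes "k \<noteq> l" and f: "homog n k d f" "homog n l (Suc d) f" and E: "polar n k l f = 0"
  shows "f = 0"
proof -
  define F where "F j = (polar n l k ^^ j) f" for j
  have hom: "homog n k (d - j) (F j) \<and> homog n l (Suc d + j) (F j)" for j
  proof (induction j)
    case (Suc j)
    have "F (Suc j) = polar n l k (F j)"
      by (simp add: F_def)
    then show ?case
      using Suc \<open>k \<noteq> l\<close> homog_polar_lower[of n k "d - j" "F j" l]
        homog_polar_raise[of n l "Suc d + j" "F j" k]
      by simp
  qed (simp add: F_def f)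
  \<comment> \<open>After \<open>d\<close> steps column \<open>k\<close> is empty, so one more
    lowering gives 0.\<close>
  have zero: "F (Suc d) = 0"
    using hom[of d] by (simp add: F_def homog_0_polar)
  \<comment> \<open>For weight \<open>-1\<close> the usual factor \<open>(j + 1) * (-1 - j)\<close>
    is \<open>-(j + 1)^2\<close>. The induction step adds the weight \<open>-(2 * j + 3)\<close> of
    \<open>F (Suc j)\<close>; the bound by \<open>d\<close> keeps the natural subtraction
    \<open>d - Suc j\<close> exact.\<close>
  have EF: "polar n k l (F (Suc j)) = scale (- (of_nat (Suc j))\<^sup>2) (F j)" if "j \<le> d" for j
    using that
  proof (induction j)
    case 0
    show ?case
      using polar_commutator[OF \<open>k \<noteq> l\<close>, of n f] polar_same[OF f(1)] polar_same[OF f(2)]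
      by (auto simp: F_def E scale_def fun_eq_iff algebra_simps)
  next
    case (Suc j)
    let ?g = "F (Suc j)"
    have "polar n k l (F (Suc (Suc j))) = polar n l k (polar n k l ?g) + polar n k k ?g - polar n l l ?g"
      using polar_commutator[OF \<open>k \<noteq> l\<close>, of n ?g] by (simp add: F_def)
    also have "polar n k l ?g = scale (- (of_nat (Suc j))\<^sup>2) (F j)"
      using Suc by simp
    also have "polar n l k (scale (- (of_nat (Suc j))\<^sup>2) (F j)) = scale (- (of_nat (Suc j))\<^sup>2) ?g"
      by (simp add: polar_scale F_def)
    also have "polar n k k ?g = scale (of_nat (d - Suc j)) ?g"
      using hom[of "Suc j"] by (intro polar_same) simp
    also have "polar n l l ?g = scale (of_nat (Suc d + Suc j)) ?g"
      using hom[of "Suc j"] by (intro polar_same) simp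
    finally show ?case
      using Suc.prems
      by (simp add: scale_def fun_eq_iff of_nat_diff power2_eq_square) (simp add: algebra_simps)
  qed
  \<comment> \<open>Raising back: \<open>E_kl\<close> sends a vanishing \<open>F (Suc i)\<close> to
    a non-zero multiple of \<open>F i\<close>, down to \<open>F 0 = f\<close>.\<close>
  have "F (Suc d - j) = 0" if "j \<le> Suc d" for j
    using that
  proof (induction j)
    case (Suc j)
    then have "F (Suc (d - j)) = 0"
      by (metis Suc_diff_le Suc_leD Suc_le_mono)
    then have "scale (- (of_nat (Suc (d - j)))\<^sup>2 :: 'a) (F (d - j)) = 0"
      using EF[of "d - j"] by (metis diff_le_self polar_0)
    moreover have "(of_nat (Suc (d - j)))\<^sup>2 \<noteq> (0::'a)"
      by (simp del: of_nat_Suc)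
    ultimately show ?case
      by (simp add: scale_def fun_eq_iff)
  qed (simp add: zero)
  from this[of "Suc d"] show ?thesis
    by (simp add: F_def)
qed

text \<open>Leibniz rule: a creator and an annihilator together pass another creator without a sign,
  and only the summand for row \<open>i\<close> leaves a contraction.\<close>

lemma polar_cre:
  assumes "i < n" "k \<noteq> l"
  shows "polar n k l (cre (mode i l) f) = cre (mode i k) f + cre (mode i l) (polar n k l f)"
proof -
  have "polar n k l (cre (mode i l) f) =
    (\<Sum>j<n. (if j = i then cre (mode i k) f else 0) + cre (mode i l) (cre (mode j k) (ann (mode j l) f)))"
    unfolding polar_def
  proof (rule sum.cong)
    fix j
    show "cre (mode j k) (ann (mode j l) (cre (mode i l) f)) =
      (if j = i then cre (mode i k) f else 0) + cre (mode i l) (cre (mode j k) (ann (mode j l) f))"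
      using cre_cre[of "mode j k" "mode i l" "ann (mode j l) f"] by (simp add: ann_cre cre_diff)
  qed simp
  then show ?thesis
    using \<open>i < n\<close> by (simp add: sum.distrib polar_def cre_sum)
qed

lemma polar_cre_other:
  assumes "j \<noteq> l"
  shows "polar n k l (cre (mode i j) f) = cre (mode i j) (polar n k l f)"
proof -
  have "cre (mode i' k) (ann (mode i' l) (cre (mode i j) f)) = cre (mode i j) (cre (mode i' k) (ann (mode i' l) f))" for i'
    using assms cre_cre[of "mode i' k" "mode i j" "ann (mode i' l) f"] by (simp add: ann_cre cre_uminus)
  then show ?thesis
    by (simp add: polar_def cre_sum)
qed

text \<open>As rewrite rules these eta-expand sums of vectors below the linear operators, so that the
  linearity lemmas no longer match.\<close>

declare plus_fun_apply [simp del] zero_fun_apply [simp del] uminus_apply [simp del]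

subsection \<open>Polarizing the top element of a column\<close>

text \<open>The factors are ordered by row rather than by column: a polarization changes the column
  of a factor and keeps its place, so no reordering signs arise.\<close>

definition row_product :: "nat list \<Rightarrow> (nat \<Rightarrow> nat) \<Rightarrow> 'a::comm_ring_1 fock \<Rightarrow> 'a fock" where
  "row_product xs \<phi> f = foldr (\<lambda>i. cre (mode i (\<phi> i))) xs f"

lemma row_product_Nil [simp]: "row_product [] \<phi> f = f"
  and row_product_Cons [simp]: "row_product (i # xs) \<phi> f = cre (mode i (\<phi> i)) (row_product xs \<phi> f)"
  by (simp_all add: row_product_def)

lemma row_product_cong:
  "(\<And>i. i \<in> set xs \<Longrightarrow> \<phi> i = \<psi> i) \<Longrightarrow> row_product xs \<phi> f = row_product xs \<psi> f"
  by (induction xs) auto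

text \<open>Iterated Leibniz rule: either the operator reaches \<open>f\<close>, or it moves one
  factor of column \<open>l\<close> to column \<open>k\<close>.\<close>

lemma polar_row_product:
  assumes "k \<noteq> l" "distinct xs" "set xs \<subseteq> {..<n}"
  shows "polar n k l (row_product xs \<phi> f) = row_product xs \<phi> (polar n k l f) +
    (\<Sum>i \<in> {i \<in> set xs. \<phi> i = l}. row_product xs (\<phi>(i := k)) f)"
  using assms(2,3)
proof (induction xs)
  case (Cons i xs)
  let ?I = "{i \<in> set xs. \<phi> i = l}"
  have other: "row_product (i # xs) (\<phi>(j := k)) f =
      cre (mode i (\<phi> i)) (row_product xs (\<phi>(j := k)) f)" if "j \<in> ?I" for j
    using that Cons.prems by auto
  have IH: "polar n k l (row_product xs \<phi> f) = row_product xs \<phi> (polar n k l f) +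
      (\<Sum>j \<in> ?I. row_product xs (\<phi>(j := k)) f)"
    by (rule Cons.IH) (use Cons.prems in auto)
  have sum: "cre (mode i (\<phi> i)) (\<Sum>j \<in> ?I. row_product xs (\<phi>(j := k)) f) =
      (\<Sum>j \<in> ?I. row_product (i # xs) (\<phi>(j := k)) f)"
    unfolding cre_sum by (rule sum.cong) (use other in auto)
  show ?case
  proof (cases "\<phi> i = l")
    case True
    have "{j \<in> set (i # xs). \<phi> j = l} = insert i ?I" "i \<notin> ?I"
      using True Cons.prems by auto
    moreover have "row_product (i # xs) (\<phi>(i := k)) f = cre (mode i k) (row_product xs \<phi> f)"
      using Cons.prems by (auto intro!: arg_cong[of _ _ "cre _"] row_product_cong)
    ultimately have "(\<Sum>j \<in> {j \<in> set (i # xs). \<phi> j = l}. row_product (i # xs) (\<phi>(j := k)) f) =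
        cre (mode i k) (row_product xs \<phi> f) + (\<Sum>j \<in> ?I. row_product (i # xs) (\<phi>(j := k)) f)"
      by (simp only: sum.insert finite_set finite_Collect_conjI Collect_mem_eq not_False_eq_True simp_thms)
    moreover have "polar n k l (row_product (i # xs) \<phi> f) =
        cre (mode i k) (row_product xs \<phi> f) + cre (mode i l) (polar n k l (row_product xs \<phi> f))"
      using Cons.prems polar_cre[of i n k l "row_product xs \<phi> f"] \<open>k \<noteq> l\<close> True by simp
    moreover have "cre (mode i l) (polar n k l (row_product xs \<phi> f)) =
        row_product (i # xs) \<phi> (polar n k l f) + (\<Sum>j \<in> ?I. row_product (i # xs) (\<phi>(j := k)) f)"
      unfolding IH cre_add sum[unfolded True] row_product_Cons[of _ _ \<phi>] True ..
    ultimately show ?thesis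
      by (simp only: add_ac)
  next
    case False
    then have "{j \<in> set (i # xs). \<phi> j = l} = ?I"
      by auto
    then show ?thesis
      using False by (simp only: row_product_Cons[of _ _ \<phi>] polar_cre_other IH cre_add sum not_False_eq_True)
  qed
qed simp

text \<open>\<open>P\<^sub>j\<close> is a sum of products over the rows, one for each way in which the columns \<open>0, \<dots>, j - 1\<close>
  can each have replaced one of the \<open>n\<close> copies of the column \<open>l\<close>.\<close>

definition assignments :: "nat \<Rightarrow> nat \<Rightarrow> nat \<Rightarrow> (nat \<Rightarrow> nat) set" where
  "assignments n l j = {\<phi> \<in> {..<n} \<rightarrow>\<^sub>E insert l {..<j}. \<forall>k<j. \<exists>!i. i < n \<and> \<phi> i = k}"

definition polarized_top :: "nat \<Rightarrow> nat \<Rightarrow> nat \<Rightarrow> 'a::comm_ring_1 fock \<Rightarrow> 'a fock" where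
  "polarized_top n l j f = (\<Sum>\<phi>\<in>assignments n l j. row_product [0..<n] \<phi> f)"

lemma finite_assignments: "finite (assignments n l j)"
  unfolding assignments_def by (rule finite_subset[OF _ finite_PiE[of "{..<n}" "\<lambda>_. insert l {..<j}"]]) auto

lemma polar_sum: "polar n k l (\<Sum>i\<in>I. F i) = (\<Sum>i\<in>I. polar n k l (F i))"
  unfolding polar_def ann_sum cre_sum by (rule sum.swap)

text \<open>Extending an assignment means choosing the row in which column \<open>j\<close> replaces
  column \<open>l\<close>. As \<open>j < l\<close>, the value \<open>j\<close> was not taken before,
  so the chosen row can be read off again.\<close>

lemma bij_assignments:
  assumes "j < l"
  shows "bij_betw (\<lambda>(\<phi>, i). \<phi>(i := j)) (Sigma (assignments n l j) (\<lambda>\<phi>. {i \<in> {..<n}. \<phi> i = l}))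
     (assignments n l (Suc j))"
proof (rule bij_betw_byWitness[where f' = "\<lambda>\<psi>. let i = (THE i. i < n \<and> \<psi> i = j) in (\<psi>(i := l), i)"])
  show "\<forall>a\<in>Sigma (assignments n l j) (\<lambda>\<phi>. {i \<in> {..<n}. \<phi> i = l}).
    (let i = THE i. i < n \<and> (case a of (\<phi>, i) \<Rightarrow> \<phi>(i := j)) i = j
      in ((case a of (\<phi>, i) \<Rightarrow> \<phi>(i := j))(i := l), i)) = a"
  proof
    fix a assume "a \<in> Sigma (assignments n l j) (\<lambda>\<phi>. {i \<in> {..<n}. \<phi> i = l})"
    then obtain \<phi> i where a: "a = (\<phi>, i)" and \<phi>: "\<phi> \<in> assignments n l j" and i: "i < n" "\<phi> i = l"
      by blast
    have ne: "\<phi> i' \<noteq> j" if "i' < n" for i'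
    proof -
      have "\<phi> i' \<in> insert l {..<j}"
        using \<phi> that by (auto simp: assignments_def)
      then show ?thesis using assms by auto
    qed
    have t: "(THE i'. i' < n \<and> (\<phi>(i := j)) i' = j) = i"
      using i ne by (intro the_equality) (auto split: if_splits)
    show "(let i = THE i. i < n \<and> (case a of (\<phi>, i) \<Rightarrow> \<phi>(i := j)) i = j
      in ((case a of (\<phi>, i) \<Rightarrow> \<phi>(i := j))(i := l), i)) = a"
      unfolding a prod.case Let_def t fun_upd_upd fun_upd_idem[where f = \<phi>, OF i(2)] ..
  qed
  have THE: "(THE i. i < n \<and> \<psi> i = j) < n \<and> \<psi> (THE i. i < n \<and> \<psi> i = j) = j"
    if "\<psi> \<in> assignments n l (Suc j)" for \<psi>
    using that by (intro theI'[where P = "\<lambda>i. i < n \<and> \<psi> i = j"]) (simp add: assignments_def)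
  show "\<forall>\<psi>\<in>assignments n l (Suc j). (case let i = THE i. i < n \<and> \<psi> i = j in (\<psi>(i := l), i) of
     (\<phi>, i) \<Rightarrow> \<phi>(i := j)) = \<psi>"
  proof
    fix \<psi> assume "\<psi> \<in> assignments n l (Suc j)"
    from THE[OF this] show "(case let i = THE i. i < n \<and> \<psi> i = j in (\<psi>(i := l), i) of
     (\<phi>, i) \<Rightarrow> \<phi>(i := j)) = \<psi>"
      unfolding Let_def prod.case fun_upd_upd by (intro fun_upd_idem) (rule conjunct2)
  qed
  show "(\<lambda>(\<phi>, i). \<phi>(i := j)) ` (Sigma (assignments n l j) (\<lambda>\<phi>. {i \<in> {..<n}. \<phi> i = l})) \<subseteq> assignments n l (Suc j)"
  proof
    fix \<psi> assume "\<psi> \<in> (\<lambda>(\<phi>, i). \<phi>(i := j)) ` (Sigma (assignments n l j) (\<lambda>\<phi>. {i \<in> {..<n}. \<phi> i = l}))"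
    then obtain \<phi> i where \<psi>: "\<psi> = \<phi>(i := j)" and \<phi>: "\<phi> \<in> assignments n l j" and i: "i < n" "\<phi> i = l"
      by (auto simp del: fun_upd_apply)
    have range: "\<phi> i' \<in> insert l {..<j}" if "i' < n" for i'
      using \<phi> that by (auto simp: assignments_def)
    then have ne: "\<phi> i' \<noteq> j" if "i' < n" for i'
      using that assms by force
    have "\<exists>!i'. i' < n \<and> (\<phi>(i := j)) i' = k" if "k < Suc j" for k
    proof (cases "k = j")
      case True
      then show ?thesis using i ne by (intro ex1I[of _ i]) (auto split: if_splits)
    next
      case False
      then have "\<exists>!i'. i' < n \<and> \<phi> i' = k"
        using \<phi> that by (auto simp: assignments_def)
      moreover have "i' < n \<and> (\<phi>(i := j)) i' = k \<longleftrightarrow> i' < n \<and> \<phi> i' = k" for i'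
        using False i that assms by auto
      ultimately show ?thesis by simp
    qed
    moreover have "\<phi>(i := j) \<in> {..<n} \<rightarrow>\<^sub>E insert l {..<Suc j}"
    proof (rule PiE_I)
      fix i' assume "i' \<in> {..<n}"
      then show "(\<phi>(i := j)) i' \<in> insert l {..<Suc j}"
        using range[of i'] by auto
    next
      fix i' assume "i' \<notin> {..<n}"
      then show "(\<phi>(i := j)) i' = undefined"
        using \<phi> i by (auto simp: assignments_def PiE_iff extensional_def)
    qed
    ultimately show "\<psi> \<in> assignments n l (Suc j)"
      unfolding \<psi> assignments_def by blast
  qed
  show "(\<lambda>\<psi>. let i = THE i. i < n \<and> \<psi> i = j in (\<psi>(i := l), i)) ` assignments n l (Suc j)
    \<subseteq> Sigma (assignments n l j) (\<lambda>\<phi>. {i \<in> {..<n}. \<phi> i = l})"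
  proof
    fix a assume "a \<in> (\<lambda>\<psi>. let i = THE i. i < n \<and> \<psi> i = j in (\<psi>(i := l), i)) ` assignments n l (Suc j)"
    then obtain \<psi> where \<psi>: "\<psi> \<in> assignments n l (Suc j)"
      and a: "a = (let i = THE i. i < n \<and> \<psi> i = j in (\<psi>(i := l), i))"
      by blast
    define i where "i = (THE i. i < n \<and> \<psi> i = j)"
    define \<phi> where \<phi>: "\<phi> = \<psi>(i := l)"
    have i: "i < n" "\<psi> i = j" and a': "a = (\<phi>, i)"
      using a THE[OF \<psi>] by (auto simp: Let_def i_def \<phi>)
    have uniq: "\<exists>!i'. i' < n \<and> \<psi> i' = k" if "k < Suc j" for k
      using \<psi> that by (auto simp: assignments_def)
    have "\<exists>!i'. i' < n \<and> \<phi> i' = k" if "k < j" for k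
    proof -
      have "i' < n \<and> \<phi> i' = k \<longleftrightarrow> i' < n \<and> \<psi> i' = k" for i'
        using that i assms by (auto simp: \<phi>)
      then show ?thesis using uniq[of k] that by simp
    qed
    moreover have "\<phi> i' \<in> insert l {..<j}" if "i' < n" for i'
    proof (cases "i' = i")
      case False
      then have "\<psi> i' \<noteq> j"
        using uniq[of j] i that by blast
      moreover have "\<psi> i' \<in> insert l {..<Suc j}"
        using \<psi> that by (auto simp: assignments_def)
      ultimately show ?thesis
        using False by (simp add: \<phi> less_Suc_eq)
    qed (simp add: \<phi>)
    moreover have "\<phi> \<in> extensional {..<n}"
      using \<psi> i by (auto simp: \<phi> assignments_def PiE_iff extensional_def)
    ultimately have "\<phi> \<in> assignments n l j"
      by (auto simp: assignments_def PiE_iff)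
    moreover have "i < n" "\<phi> i = l" using i by (auto simp: \<phi>)
    ultimately show "a \<in> Sigma (assignments n l j) (\<lambda>\<phi>. {i \<in> {..<n}. \<phi> i = l})"
      unfolding a' by blast
  qed
qed

text \<open>This is the recursion \<open>P_(j+1) = [E_jl, P_j]\<close>: the Leibniz terms that do
  not reach \<open>f\<close> give one further row to column \<open>j\<close>, and
  \<open>bij_assignments\<close> collects them.\<close>

lemma polar_polarized_top:
  assumes "j < l"
  shows "polar n j l (polarized_top n l j f) =
    polarized_top n l j (polar n j l f) + polarized_top n l (Suc j) f"
proof -
  have "polar n j l (polarized_top n l j f) =
    (\<Sum>\<phi>\<in>assignments n l j. row_product [0..<n] \<phi> (polar n j l f) +
      (\<Sum>i \<in> {i \<in> {..<n}. \<phi> i = l}. row_product [0..<n] (\<phi>(i := j)) f))"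
    unfolding polarized_top_def polar_sum
    using assms by (intro sum.cong) (auto simp: polar_row_product atLeast0LessThan)
  also have "\<dots> = polarized_top n l j (polar n j l f) +
    (\<Sum>\<phi>\<in>assignments n l j. \<Sum>i \<in> {i \<in> {..<n}. \<phi> i = l}. row_product [0..<n] (\<phi>(i := j)) f)"
    by (simp only: sum.distrib polarized_top_def)
  also have "(\<Sum>\<phi>\<in>assignments n l j. \<Sum>i \<in> {i \<in> {..<n}. \<phi> i = l}. row_product [0..<n] (\<phi>(i := j)) f) =
    (\<Sum>(\<phi>, i)\<in>Sigma (assignments n l j) (\<lambda>\<phi>. {i \<in> {..<n}. \<phi> i = l}). row_product [0..<n] (\<phi>(i := j)) f)"
    by (rule sum.Sigma) (auto simp: finite_assignments)
  also have "\<dots> = (\<Sum>\<psi>\<in>assignments n l (Suc j). row_product [0..<n] \<psi> f)"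
    by (subst sum.reindex_bij_betw[OF bij_assignments[OF assms], symmetric])
      (simp add: case_prod_unfold)
  finally show ?thesis
    by (simp only: polarized_top_def)
qed

lemma homog_row_product:
  assumes "homog n l d f" "set xs \<subseteq> {..<n}"
  shows "homog n l (d + length (filter (\<lambda>i. \<phi> i = l) xs)) (row_product xs \<phi> f)"
  using assms(2)
proof (induction xs)
  case (Cons i xs)
  then show ?case
    using homog_cre[of n l _ "row_product xs \<phi> f" i] homog_cre_other[of n l _ "row_product xs \<phi> f" "\<phi> i" i]
    by auto
qed (simp add: assms)

text \<open>The columns below \<open>j\<close> take one row each, and \<open>j \<le> l\<close>
  ensures that \<open>l\<close> is not among them.\<close>

lemma card_assignments_last:
  assumes "\<phi> \<in> assignments n l j" "j \<le> l"
  shows "length (filter (\<lambda>i. \<phi> i = l) [0..<n]) = n - j" "j \<le> n"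
proof -
  have bij: "bij_betw \<phi> {i \<in> {..<n}. \<phi> i \<noteq> l} {..<j}"
  proof -
    have uniq: "\<exists>!i. i < n \<and> \<phi> i = k" if "k < j" for k
      using assms(1) that by (auto simp: assignments_def)
    have range: "\<phi> i \<in> insert l {..<j}" if "i < n" for i
      using assms(1) that by (auto simp: assignments_def)
    show ?thesis
      unfolding bij_betw_def
    proof safe
      show "inj_on \<phi> {i \<in> {..<n}. \<phi> i \<noteq> l}"
      proof (rule inj_onI)
        fix x y assume "x \<in> {i \<in> {..<n}. \<phi> i \<noteq> l}" "y \<in> {i \<in> {..<n}. \<phi> i \<noteq> l}" "\<phi> x = \<phi> y"
        then show "x = y" using uniq[of "\<phi> x"] range[of x] by auto
      qed
    next
      fix i assume "i < n" "\<phi> i \<noteq> l"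
      then show "\<phi> i < j" using range[of i] by auto
    next
      fix k assume k: "k < j"
      then obtain i where "i < n" "\<phi> i = k" using uniq by blast
      then show "k \<in> \<phi> ` {i \<in> {..<n}. \<phi> i \<noteq> l}"
        using k assms(2) by auto
    qed
  qed
  then have j: "card {i \<in> {..<n}. \<phi> i \<noteq> l} = j"
    using bij_betw_same_card by fastforce
  have "{..<n} - {i \<in> {..<n}. \<phi> i \<noteq> l} = {i \<in> {..<n}. \<phi> i = l}"
    by auto
  moreover have "card ({..<n} - {i \<in> {..<n}. \<phi> i \<noteq> l}) = n - j"
    using j by (subst card_Diff_subset) auto
  moreover have "length (filter (\<lambda>i. \<phi> i = l) [0..<n]) = card {i \<in> {..<n}. \<phi> i = l}"
    by (subst distinct_card[symmetric]) (auto intro!: arg_cong[of _ _ card])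
  ultimately show "length (filter (\<lambda>i. \<phi> i = l) [0..<n]) = n - j" by simp
  show "j \<le> n" using j card_mono[of "{..<n}" "{i \<in> {..<n}. \<phi> i \<noteq> l}"] by auto
qed

lemma homog_polarized_top:
  assumes "homog n l d f" "j \<le> l"
  shows "homog n l (d + (n - j)) (polarized_top n l j f)"
  unfolding polarized_top_def
proof (rule homog_sum)
  fix \<phi> assume "\<phi> \<in> assignments n l j"
  then show "homog n l (d + (n - j)) (row_product [0..<n] \<phi> f)"
    using homog_row_product[OF assms(1), of "[0..<n]" \<phi>] card_assignments_last[OF _ assms(2)]
    by (simp add: atLeast0LessThan)
qed

text \<open>Filling empty modes loses nothing: the coefficient at \<open>S\<close> reappears, up to
  sign, at \<open>S\<close> with those modes added.\<close>

lemma row_product_const_inj: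
  fixes f :: "'a::idom fock"
  assumes "distinct xs" "row_product xs (\<lambda>_. l) f (S \<union> (\<lambda>i. mode i l) ` set xs) = 0"
    "\<And>i. i \<in> set xs \<Longrightarrow> mode i l \<notin> S"
  shows "f S = 0"
  using assms
proof (induction xs)
  case (Cons i xs)
  let ?T = "S \<union> (\<lambda>i. mode i l) ` set xs"
  have "mode i l \<notin> ?T"
    using Cons.prems by (auto simp: prod_encode_eq)
  then have "insert (mode i l) ?T - {mode i l} = ?T"
    by simp
  then have "row_product xs (\<lambda>_. l) f ?T = 0"
    using Cons.prems(2) by (simp add: cre_def)
  then show ?case
    using Cons by auto
qed simp

text \<open>The degree conditions are chosen to survive the induction: \<open>E_jl\<close> lowers
  column \<open>l\<close> from \<open>Suc j\<close> to \<open>j\<close> and leaves the columns below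
  \<open>j\<close> alone. For \<open>j = l\<close> they say that every column
  \<open>k \<le> l\<close> has degree \<open>k\<close>.\<close>

lemma polarized_top_inj:
  fixes f :: "'a::field_char_0 fock"
  assumes "j \<le> l" "l < n" "homog n l j f" "\<And>k. k < j \<Longrightarrow> homog n k k f" "polarized_top n l j f = 0"
  shows "f = 0"
  using assms
proof (induction j arbitrary: f)
  case 0
  \<comment> \<open>Only the constant assignment remains, so \<open>P_0\<close> fills column
    \<open>l\<close>, which is empty in degree 0.\<close>
  have "assignments n l 0 = {\<lambda>i\<in>{..<n}. l}"
    by (auto simp: assignments_def PiE_iff extensional_def)
  then have top: "row_product [0..<n] (\<lambda>_. l) f = 0"
    using "0.prems"(5) row_product_cong[of "[0..<n]" "\<lambda>i\<in>{..<n}. l" "\<lambda>_. l" f]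
    by (simp add: polarized_top_def)
  show ?case
  proof (rule ccontr)
    assume "f \<noteq> 0"
    then obtain S where S: "f S \<noteq> 0" by (auto simp: fun_eq_iff zero_fun_apply)
    then have "occupied n l S = {}"
      using "0.prems"(3) by (auto simp: homog_def)
    then show False
      using row_product_const_inj[of "[0..<n]" l f S] top S by (auto simp: occupied_def zero_fun_apply)
  qed
next
  case (Suc j)
  \<comment> \<open>The degree in column \<open>l\<close> would be
    \<open>(j + 1) + (n - j) = n + 1\<close>, one more than the column can hold.\<close>
  have "homog n l (Suc j + (n - j)) (polarized_top n l j f)"
    using Suc.prems by (intro homog_polarized_top) auto
  then have "polarized_top n l j f = 0"
    by (rule homog_gt) (use Suc.prems in auto)
  then have "polarized_top n l j (polar n j l f) = 0"
    using polar_polarized_top[of j l n f] Suc.prems by (metis Suc_le_eq add.right_neutral polar_0)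
  moreover have "homog n l j (polar n j l f)"
    using homog_polar_lower[of n l "Suc j" f j] Suc.prems by simp
  moreover have "homog n k k (polar n j l f)" if "k < j" for k
    using Suc.prems that by (intro homog_polar_other) auto
  ultimately have "polar n j l f = 0"
    using Suc.IH Suc.prems by simp
  \<comment> \<open>Since \<open>f\<close> has degree \<open>j\<close> in column \<open>j\<close>
    and \<open>Suc j\<close> in column \<open>l\<close>, it has weight \<open>-1\<close> for
    \<open>E_jl\<close>.\<close>
  then show ?case
    using polar_inj[of j l n j f] Suc.prems by simp
qed

subsection \<open>The flattening of a tensor\<close>

text \<open>The parameter \<open>a\<close> is the tensor factor, hence the column, of the first
  letter.\<close>

fun cre_word :: "nat \<Rightarrow> nat list \<Rightarrow> 'a::comm_ring_1 fock \<Rightarrow> 'a fock" where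
  "cre_word a [] f = f"
| "cre_word a (i # is) f = cre (mode i a) (cre_word (Suc a) is f)"

text \<open>The map \<open>Phi(T)\<close>, defined on the whole Fock space; the graded pieces enter
  later through conditions on supports and degrees.\<close>

definition flattening :: "nat list \<Rightarrow> 'a::field tensor \<Rightarrow> 'a fock \<Rightarrow> 'a fock" where
  "flattening ns T f = (\<Sum>is\<in>tensor_index ns. scale (T is) (cre_word 0 is f))"

definition cre_vec :: "'a::field vec \<Rightarrow> nat \<Rightarrow> 'a fock \<Rightarrow> 'a fock" where
  "cre_vec v k f = (\<Sum>i<dim_vec v. scale (v $ i) (cre (mode i k) f))"

fun cre_vecs :: "nat \<Rightarrow> 'a::field vec list \<Rightarrow> 'a fock \<Rightarrow> 'a fock" where
  "cre_vecs a [] f = f"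
| "cre_vecs a (v # vs) f = cre_vec v a (cre_vecs (Suc a) vs f)"

lemma scale_scale: "scale a (scale b f) = scale (a * b) f"
  by (simp add: scale_def mult_ac)

lemma scale_1 [simp]: "scale 1 f = f"
  by (simp add: scale_def)

lemma scale_0_left [simp]: "scale 0 f = 0"
  by (simp add: scale_def fun_eq_iff zero_fun_apply)

lemma scale_0_right [simp]: "scale c 0 = 0"
  by (simp add: scale_def fun_eq_iff zero_fun_apply)

lemma scale_sum: "scale c (\<Sum>i\<in>I. F i) = (\<Sum>i\<in>I. scale c (F i))"
  by (simp add: scale_def fun_eq_iff sum_fock_apply sum_distrib_left)

lemma scale_sum_left: "scale (\<Sum>i\<in>I. c i) f = (\<Sum>i\<in>I. scale (c i) f)"
  by (simp add: scale_def fun_eq_iff sum_fock_apply sum_distrib_right)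

lemma scale_uminus: "scale c (- f) = - scale c f"
  by (simp add: scale_def fun_eq_iff uminus_apply)

lemma scale_uminus_left: "scale (- c) f = - scale c f"
  by (simp add: scale_def fun_eq_iff uminus_apply)

lemma tensor_index_Nil: "tensor_index [] = {[]}"
  by (auto simp: tensor_index_def)

lemma tensor_index_Cons: "tensor_index (m # ns) = (\<lambda>(i, is). i # is) ` ({..<m} \<times> tensor_index ns)"
  by (auto simp: tensor_index_def list_all2_Cons2)

lemma sum_tensor_index_Cons:
  "(\<Sum>is\<in>tensor_index (m # ns). g is) = (\<Sum>i<m. \<Sum>is\<in>tensor_index ns. g (i # is))"
proof -
  have "inj_on (\<lambda>(i, is). i # is) ({..<m} \<times> tensor_index ns)"
    by (auto simp: inj_on_def)
  then show ?thesis
    by (simp add: tensor_index_Cons sum.reindex sum.cartesian_product case_prod_unfold)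
qed

lemma cre_vecs_expand:
  "cre_vecs a vs f = (\<Sum>is\<in>tensor_index (map dim_vec vs). scale (pure_tensor vs is) (cre_word a is f))"
proof (induction vs arbitrary: a)
  case Nil
  show ?case by (simp add: tensor_index_Nil pure_tensor_Nil)
next
  case (Cons v vs)
  have "cre_vecs a (v # vs) f = (\<Sum>i<dim_vec v. \<Sum>is\<in>tensor_index (map dim_vec vs).
      scale (v $ i) (cre (mode i a) (scale (pure_tensor vs is) (cre_word (Suc a) is f))))"
    unfolding cre_vecs.simps cre_vec_def Cons cre_sum scale_sum ..
  also have "\<dots> = (\<Sum>i<dim_vec v. \<Sum>is\<in>tensor_index (map dim_vec vs).
      scale (pure_tensor (v # vs) (i # is)) (cre_word a (i # is) f))"
    by (intro sum.cong) (auto simp: pure_tensor_Cons scale_scale cre_scale)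
  also have "\<dots> = (\<Sum>is\<in>tensor_index (map dim_vec (v # vs)).
      scale (pure_tensor (v # vs) is) (cre_word a is f))"
    by (simp only: list.map sum_tensor_index_Cons)
  finally show ?case .
qed

lemma flattening_pure:
  assumes "map dim_vec vs = ns"
  shows "flattening ns (pure_tensor vs) f = cre_vecs 0 vs f"
  unfolding flattening_def cre_vecs_expand assms ..

lemma flattening_sum:
  "flattening ns (\<lambda>is. \<Sum>r\<in>R. c r * F r is) f = (\<Sum>r\<in>R. scale (c r) (flattening ns (F r) f))"
  unfolding flattening_def scale_sum_left scale_sum scale_scale by (rule sum.swap)

lemma flattening_unit_vecs:
  assumes "ks \<in> tensor_index ns"
  shows "flattening ns (pure_tensor (map2 unit_vec ns ks)) f = cre_word 0 ks f"
proof -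
  have "flattening ns (pure_tensor (map2 unit_vec ns ks)) f =
    (\<Sum>is\<in>tensor_index ns. if is = ks then cre_word 0 ks f else 0)"
    unfolding flattening_def by (rule sum.cong) (auto simp: pure_tensor_unit_vecs[OF assms])
  then show ?thesis
    using assms by (simp add: finite_tensor_index)
qed

lemma flattening_det:
  "flattening (replicate n n) (det_tensor n :: 'a::field tensor) f =
    (\<Sum>\<sigma> | \<sigma> permutes {..<n}. scale (of_int (sign \<sigma>)) (cre_word 0 (map \<sigma> [0..<n]) f))"
proof -
  have "flattening (replicate n n) (pure_tensor (map (\<lambda>j. unit_vec n (\<sigma> j)) [0..<n])) f =
      cre_word 0 (map \<sigma> [0..<n]) f" if "\<sigma> permutes {..<n}" for \<sigma>
  proof -
    have "map \<sigma> [0..<n] \<in> tensor_index (replicate n n)"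
      using permutes_in_image[OF that] by (auto simp: tensor_index_def list_all2_conv_all_nth)
    moreover have "map (\<lambda>j. unit_vec n (\<sigma> j) :: 'a vec) [0..<n] = map2 unit_vec (replicate n n) (map \<sigma> [0..<n])"
      by (rule nth_equalityI) auto
    ultimately show ?thesis
      by (simp only: flattening_unit_vecs)
  qed
  then show ?thesis
    unfolding det_tensor_def flattening_sum by (intro sum.cong) simp_all
qed

section \<open>Exterior multiplication by vectors and the image of a pure tensor\<close>

lemma cre_vec_0 [simp]: "cre_vec v k 0 = 0"
  by (simp add: cre_vec_def)

lemma cre_vec_anticommute: "cre_vec u k (cre_vec v l f) = - cre_vec v l (cre_vec u k f)"
proof -
  have expand: "cre_vec u k (cre_vec v l f) = (\<Sum>i<dim_vec u. \<Sum>j<dim_vec v.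
      scale (u $ i * v $ j) (cre (mode i k) (cre (mode j l) f)))" for u v :: "'a vec" and k l
    unfolding cre_vec_def cre_sum scale_sum cre_scale scale_scale ..
  have "cre_vec u k (cre_vec v l f) = (\<Sum>j<dim_vec v. \<Sum>i<dim_vec u.
      scale (u $ i * v $ j) (cre (mode i k) (cre (mode j l) f)))"
    unfolding expand by (rule sum.swap)
  also have "\<dots> = (\<Sum>j<dim_vec v. \<Sum>i<dim_vec u.
      - scale (v $ j * u $ i) (cre (mode j l) (cre (mode i k) f)))"
    by (intro sum.cong refl, subst cre_cre) (simp add: scale_uminus mult.commute)
  also have "\<dots> = - cre_vec v l (cre_vec u k f)"
    unfolding expand sum_negf ..
  finally show ?thesis .
qed

text \<open>Anticommuting with itself makes the square its own negative, and 2 is invertible in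
  characteristic 0.\<close>

lemma cre_vec_square: "cre_vec u k (cre_vec u k f) = 0" for u :: "'a::field_char_0 vec"
proof
  fix S
  have "cre_vec u k (cre_vec u k f) S = - (cre_vec u k (cre_vec u k f) S)"
    by (metis cre_vec_anticommute uminus_apply)
  then show "cre_vec u k (cre_vec u k f) S = 0 S"
    by (simp add: zero_fun_apply)
qed

text \<open>The outer factor moves inward, changing only signs, until it meets its own copy and
  squares to 0.\<close>

lemma cre_vec_cre_vecs:
  fixes vs :: "'a::field_char_0 vec list"
  assumes "j < length vs"
  shows "cre_vec (vs ! j) (a + j) (cre_vecs a vs f) = 0"
  using assms
proof (induction vs arbitrary: a j)
  case (Cons v vs)
  show ?case
  proof (cases j)
    case 0
    then show ?thesis by (simp add: cre_vec_square)
  next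
    case (Suc i)
    then have "cre_vec (vs ! i) (Suc a + i) (cre_vecs (Suc a) vs f) = 0"
      using Cons.IH[of i "Suc a"] Cons.prems by simp
    then show ?thesis
      using Suc cre_vec_anticommute[of "vs ! i" "Suc a + i" v a "cre_vecs (Suc a) vs f"] by simp
  qed
qed simp

text \<open>If \<open>v \<and> z = 0\<close> and \<open>v\<^sub>p \<noteq> 0\<close>, then the coordinates of \<open>z\<close> at the basis vectors containing
  \<open>e\<^sub>p\<close> determine the other ones. Applied to \<open>z = \<Phi>(v\<^sub>0 \<otimes> v\<^sub>1 \<otimes> \<dots>) f\<close>, column by column, this bounds
  the rank of \<open>\<Phi>\<close> of a pure tensor.\<close>

lemma pivots_determine:
  fixes z :: "'a::field fock"
  assumes kill: "\<And>k. k < m \<Longrightarrow> cre_vec (v k) k z = 0"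
    and pivot: "\<And>k. k < m \<Longrightarrow> p k < dim_vec (v k)" "\<And>k. k < m \<Longrightarrow> v k $ p k \<noteq> 0"
    and vanish: "\<And>S. (\<And>k. k < m \<Longrightarrow> mode (p k) k \<in> S) \<Longrightarrow> z S = 0"
  shows "z = 0"
proof -
  \<comment> \<open>Induction on the number \<open>j\<close> of last columns in which the pivot need
    not be occupied.\<close>
  have "z S = 0" if "j \<le> m" "\<And>k. k < m - j \<Longrightarrow> mode (p k) k \<in> S" for j S
    using that
  proof (induction j arbitrary: S)
    case 0
    then show ?case by (intro vanish) simp
  next
    case (Suc j)
    define k where "k = m - Suc j"
    have k: "k < m" "m - j = Suc k"
      using Suc.prems(1) by (auto simp: k_def)
    have S: "mode (p k') k' \<in> S" if "k' < k" for k'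
      using Suc.prems(2) that by (simp add: k_def)
    have IH: "z S' = 0" if "\<And>k'. k' < Suc k \<Longrightarrow> mode (p k') k' \<in> S'" for S'
      using Suc.IH[of S'] Suc.prems(1) that k(2) by simp
    show ?case
    proof (cases "mode (p k) k \<in> S")
      case True
      then show ?thesis
        using S by (intro IH) (auto simp: less_Suc_eq)
    next
      case False
      let ?S = "insert (mode (p k) k) S"
      have zero: "cre (mode i k) z ?S = 0" if "i \<noteq> p k" for i
      proof (cases "mode i k \<in> ?S")
        case True
        have "z (?S - {mode i k}) = 0"
          using S that by (intro IH) (auto simp: less_Suc_eq prod_encode_eq)
        then show ?thesis by (simp add: cre_def)
      qed (simp add: cre_def)
      \<comment> \<open>Compare coefficients at \<open>S\<close> with the pivot of column
        \<open>k\<close> added. Removing any other mode of that column leaves a set containing the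
        pivot, where \<open>z\<close> vanishes by induction; only the term with \<open>z S\<close>
        survives.\<close>
      have "0 = cre_vec (v k) k z ?S"
        using kill[OF k(1)] by (simp add: zero_fun_apply)
      also have "\<dots> = (\<Sum>i<dim_vec (v k). if i = p k then v k $ i * cre (mode i k) z ?S else 0)"
        unfolding cre_vec_def sum_fock_apply by (intro sum.cong) (auto simp: scale_def zero)
      also have "\<dots> = v k $ p k * cre (mode (p k) k) z ?S"
        using pivot(1)[OF k(1)] by simp
      also have "\<dots> = v k $ p k * (jw_sign (mode (p k) k) ?S * z S)"
        using False by (simp add: cre_def)
      finally show ?thesis
        using pivot(2)[OF k(1)] by simp
    qed
  qed
  from this[of m] show ?thesis
    by (simp add: fun_eq_iff zero_fun_apply)
qed

text \<open>In both words the later of the two factors is carried across \<open>ys\<close> at the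
  same cost in sign; the remaining exchange of \<open>a\<close> and \<open>b\<close> gives the minus
  sign.\<close>

lemma foldr_cre_swap:
  fixes f :: "'a::comm_ring_1 fock"
  shows "foldr cre (xs @ a # ys @ b # zs) f = - foldr cre (xs @ b # ys @ a # zs) f"
proof -
  have pass: "foldr cre (ys @ [a]) g = scale ((- 1) ^ length ys) (foldr cre (a # ys) g)" for ys a and g :: "'a fock"
  proof (induction ys)
    case (Cons y ys)
    then show ?case
      using cre_cre[of y a "foldr cre ys g"] by (simp add: cre_scale) (simp add: scale_def fun_eq_iff uminus_apply)
  qed simp
  have uminus: "foldr cre xs (- g) = - foldr cre xs g" for xs and g :: "'a fock"
    by (induction xs) (auto simp: cre_uminus)
  have scale: "foldr cre xs (scale c g) = scale c (foldr cre xs g)" for xs c and g :: "'a fock"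
    by (induction xs) (auto simp: cre_scale)
  have "foldr cre (a # ys @ [b]) g = - foldr cre (b # ys @ [a]) g" for g :: "'a fock"
    using pass[of ys b g] pass[of ys a g] cre_cre[of a b "foldr cre ys g"]
    by (simp add: cre_scale scale_uminus)
  from this[of "foldr cre zs f"] show ?thesis
    by (simp add: uminus)
qed

lemma foldr_cre_permute:
  assumes "\<tau> permutes {..<n}"
  shows "foldr cre (map (y \<circ> \<tau>) [0..<n]) f = scale (of_int (sign \<tau>)) (foldr cre (map y [0..<n]) f)"
  using finite_lessThan assms
proof (induction \<tau> rule: permutes_rev_induct)
  case id
  show ?case by (simp add: sign_id)
next
  case (swap a b \<tau>)
  have main: "foldr cre (map (y \<circ> (\<tau> \<circ> Transposition.transpose a b)) [0..<n]) f =
      - foldr cre (map (y \<circ> \<tau>) [0..<n]) f" if ab: "a < b" "b < n" for a b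
  proof -
    have split: "[0..<n] = [0..<a] @ a # [Suc a..<b] @ b # [Suc b..<n]"
      using ab upt_add_eq_append[of 0 a "n - a"] upt_add_eq_append[of "Suc a" b "n - b"]
        upt_conv_Cons[of a n] upt_conv_Cons[of b n] by simp
    have "map (y \<circ> (\<tau> \<circ> Transposition.transpose a b)) [0..<n] =
        map (y \<circ> \<tau>) [0..<a] @ y (\<tau> b) # map (y \<circ> \<tau>) [Suc a..<b] @ y (\<tau> a) # map (y \<circ> \<tau>) [Suc b..<n]"
      unfolding split map_append list.map using ab by (auto simp: Transposition.transpose_def)
    moreover have "map (y \<circ> \<tau>) [0..<n] =
        map (y \<circ> \<tau>) [0..<a] @ y (\<tau> a) # map (y \<circ> \<tau>) [Suc a..<b] @ y (\<tau> b) # map (y \<circ> \<tau>) [Suc b..<n]"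
      unfolding split map_append list.map by simp
    ultimately show ?thesis
      by (simp only: foldr_cre_swap[of "map (y \<circ> \<tau>) [0..<a]" "y (\<tau> b)"])
  qed
  have "foldr cre (map (y \<circ> (\<tau> \<circ> Transposition.transpose a b)) [0..<n]) f =
      - foldr cre (map (y \<circ> \<tau>) [0..<n]) f"
    using main[of a b] main[of b a] swap.hyps by (cases a b rule: linorder_cases) (auto simp: transpose_commute)
  moreover have "sign (\<tau> \<circ> Transposition.transpose a b) = - sign \<tau>"
    using swap by (subst sign_compose) (auto simp: permutation_swap_id sign_swap_id intro: permutes_imp_permutation)
  ultimately show ?case
    by (simp only: swap.IH of_int_minus scale_uminus_left)
qed

subsection \<open>The bound\<close>

definition modes :: "nat \<Rightarrow> nat set" where
  "modes n = (\<lambda>(i, k). mode i k) ` ({..<n} \<times> {..<n})"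

text \<open>Indexes the standard basis of the tensor product of the exterior powers
  \<open>Lambda^(d k) V\<close> over \<open>k < n\<close>.\<close>

definition basis :: "nat \<Rightarrow> (nat \<Rightarrow> nat) \<Rightarrow> nat set set" where
  "basis n d = {S. S \<subseteq> modes n \<and> (\<forall>k<n. card (occupied n k S) = d k)}"

definition delta :: "nat set \<Rightarrow> 'a::comm_ring_1 fock" where
  "delta S = (\<lambda>S'. if S' = S then 1 else 0)"

lemma finite_modes [simp]: "finite (modes n)"
  by (simp add: modes_def)

lemma finite_basis [simp]: "finite (basis n d)"
  by (rule finite_subset[of _ "Pow (modes n)"]) (auto simp: basis_def)

text \<open>A set of modes is the same as the tuple of its columns, and these can be chosen
  independently.\<close>

lemma card_occupied_family:
  assumes "\<And>k. k < n \<Longrightarrow> \<F> k \<subseteq> Pow {..<n}"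
  shows "card {S. S \<subseteq> modes n \<and> (\<forall>k<n. occupied n k S \<in> \<F> k)} = (\<Prod>k<n. card (\<F> k))"
proof -
  let ?f = "\<lambda>S. \<lambda>k\<in>{..<n}. occupied n k S" and ?g = "\<lambda>B. {mode i k | i k. k < n \<and> i \<in> B k}"
  have "bij_betw ?f {S. S \<subseteq> modes n \<and> (\<forall>k<n. occupied n k S \<in> \<F> k)} (Pi\<^sub>E {..<n} \<F>)"
  proof (rule bij_betw_byWitness[where f' = ?g])
    show "\<forall>S\<in>{S. S \<subseteq> modes n \<and> (\<forall>k<n. occupied n k S \<in> \<F> k)}. ?g (?f S) = S"
      by (fastforce simp: occupied_def modes_def)
    have occupied: "occupied n k (?g B) = B k" if "B \<in> Pi\<^sub>E {..<n} \<F>" "k < n" for B k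
      using that assms[of k] by (fastforce simp: occupied_def prod_encode_eq PiE_iff)
    then show "\<forall>B\<in>Pi\<^sub>E {..<n} \<F>. ?f (?g B) = B"
      by (auto simp: fun_eq_iff PiE_iff extensional_def)
    show "?f ` {S. S \<subseteq> modes n \<and> (\<forall>k<n. occupied n k S \<in> \<F> k)} \<subseteq> Pi\<^sub>E {..<n} \<F>"
      by auto
    have sub: "?g B \<subseteq> modes n" if "B \<in> Pi\<^sub>E {..<n} \<F>" for B
      using that assms by (fastforce simp: modes_def PiE_iff)
    show "?g ` Pi\<^sub>E {..<n} \<F> \<subseteq> {S. S \<subseteq> modes n \<and> (\<forall>k<n. occupied n k S \<in> \<F> k)}"
    proof (rule image_subsetI)
      fix B assume B: "B \<in> Pi\<^sub>E {..<n} \<F>"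
      have "occupied n k (?g B) \<in> \<F> k" if "k < n" for k
        unfolding occupied[OF B that] using B that by (auto simp: PiE_iff)
      then show "?g B \<in> {S. S \<subseteq> modes n \<and> (\<forall>k<n. occupied n k S \<in> \<F> k)}"
        using sub[OF B] by blast
    qed
  qed
  then show ?thesis
    by (simp add: bij_betw_same_card card_PiE)
qed

lemma occupied_subset: "occupied n k S \<subseteq> {..<n}"
  by (auto simp: occupied_def)

lemma card_basis: "card (basis n d) = (\<Prod>k<n. n choose d k)"
proof -
  have "basis n d = {S. S \<subseteq> modes n \<and> (\<forall>k<n. occupied n k S \<in> {B. B \<subseteq> {..<n} \<and> card B = d k})}"
    using occupied_subset by (auto simp: basis_def)
  then show ?thesis
    by (simp only: card_occupied_family[of n "\<lambda>k. {B. B \<subseteq> {..<n} \<and> card B = d k}"] n_subsets finite_lessThan card_lessThan)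
       (subst card_occupied_family, auto simp: n_subsets)
qed

lemma card_subsets_with_element:
  assumes "finite A" "p \<in> A"
  shows "card {B. B \<subseteq> A \<and> card B = Suc d \<and> p \<in> B} = (card A - 1) choose d"
proof -
  have "bij_betw (insert p) {B. B \<subseteq> A - {p} \<and> card B = d} {B. B \<subseteq> A \<and> card B = Suc d \<and> p \<in> B}"
  proof (rule bij_betw_byWitness[where f' = "\<lambda>B. B - {p}"])
    have "finite B" if "B \<subseteq> A" for B
      using that assms(1) finite_subset by blast
    then show "insert p ` {B. B \<subseteq> A - {p} \<and> card B = d} \<subseteq> {B. B \<subseteq> A \<and> card B = Suc d \<and> p \<in> B}"
      using assms(2) by (auto simp: card_insert_if subset_Diff_insert)
  qed auto
  then show ?thesis
    using assms by (simp add: bij_betw_same_card[symmetric] n_subsets)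
qed

text \<open>By \<open>pivots_determine\<close> these coordinates determine the image of a pure
  tensor, so their number bounds the rank of its flattening.\<close>

lemma card_basis_pivots:
  assumes "\<And>k. k < n \<Longrightarrow> p k < n"
  shows "card {S \<in> basis n Suc. \<forall>k<n. mode (p k) k \<in> S} = (\<Prod>k<n. (n - 1) choose k)"
proof -
  have "{S \<in> basis n Suc. \<forall>k<n. mode (p k) k \<in> S} =
      {S. S \<subseteq> modes n \<and> (\<forall>k<n. occupied n k S \<in> {B. B \<subseteq> {..<n} \<and> card B = Suc k \<and> p k \<in> B})}"
    using occupied_subset assms mem_occupied by (fastforce simp: basis_def)
  also have "card \<dots> = (\<Prod>k<n. card {B. B \<subseteq> {..<n} \<and> card B = Suc k \<and> p k \<in> B})"
    by (rule card_occupied_family) auto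
  also have "\<dots> = (\<Prod>k<n. (n - 1) choose k)"
    using assms by (intro prod.cong) (simp_all add: card_subsets_with_element)
  finally show ?thesis .
qed

text \<open>Source and target of \<open>Phi\<close> have equal dimension, so its matrix is square:
  the two products differ only by the factors \<open>n choose 0\<close> and
  \<open>n choose n\<close>, both 1.\<close>

lemma card_basis_shift: "card (basis n Suc) = card (basis n (\<lambda>k. k))"
proof -
  have "(\<Prod>k<n. n choose Suc k) = (\<Prod>k<Suc n. n choose k)"
    by (subst prod.lessThan_Suc_shift) simp
  then show ?thesis
    by (simp add: card_basis)
qed

text \<open>Multiply \<open>(n - k) * (n choose k) = n * ((n - 1) choose k)\<close> over
  \<open>k < n\<close>; the factors \<open>n - k\<close> give \<open>fact n\<close>.\<close>

lemma prod_binomial_ratio: "(\<Prod>k<n. n choose k) * fact n = n ^ n * (\<Prod>k<n. (n - 1) choose k)"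
proof -
  have "(\<Prod>k<n. n choose k) * fact n = (\<Prod>k<n. (n - k) * (n choose k))"
    by (simp add: prod.distrib fact_prod_rev atLeast0LessThan)
  also have "\<dots> = (\<Prod>k<n. n * ((n - 1) choose k))"
    by (rule prod.cong[OF refl]) (rule binomial_absorb_comp)
  also have "\<dots> = n ^ n * (\<Prod>k<n. (n - 1) choose k)"
    by (simp add: prod.distrib)
  finally show ?thesis .
qed

section \<open>Degrees and matrix of the flattening\<close>

lemma support_basisI:
  assumes "\<And>S. f S \<noteq> 0 \<Longrightarrow> S \<subseteq> modes n" "\<And>k. k < n \<Longrightarrow> homog n k (d k) f"
  shows "f S \<noteq> 0 \<Longrightarrow> S \<in> basis n d"
  using assms by (auto simp: basis_def homog_def)

lemma homog_basis:
  assumes "\<And>S. f S \<noteq> 0 \<Longrightarrow> S \<in> basis n d" "k < n"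
  shows "homog n k (d k) f"
  using assms by (auto simp: basis_def homog_def)

lemma cre_word_support:
  assumes "\<forall>i\<in>set is. i < n" "a + length is \<le> n"
    and "\<And>S. f S \<noteq> 0 \<Longrightarrow> S \<in> basis n d"
  shows "cre_word a is f S \<noteq> 0 \<Longrightarrow> S \<in> basis n (\<lambda>k. if a \<le> k \<and> k < a + length is then Suc (d k) else d k)"
  using assms(1,2)
proof (induction "is" arbitrary: a S)
  case Nil
  then show ?case using assms(3)[of S] by (auto simp: basis_def)
next
  case (Cons i "is")
  let ?g = "cre_word (Suc a) is f"
  let ?d = "\<lambda>k. if Suc a \<le> k \<and> k < Suc a + length is then Suc (d k) else d k"
  have supp: "S \<in> basis n ?d" if "?g S \<noteq> 0" for S
    using Cons.IH[OF that] Cons.prems by simp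
  have hom: "homog n k (?d k) ?g" if "k < n" for k
    using supp that by (rule homog_basis[of ?g n ?d k]) auto
  show ?case
  proof (rule support_basisI[of "cre_word a (i # is) f"])
    show "cre_word a (i # is) f S \<noteq> 0" by fact
  next
    fix S assume "cre_word a (i # is) f S \<noteq> 0"
    then have "?g (S - {mode i a}) \<noteq> 0"
      by (auto simp: cre_def split: if_splits)
    then have "S - {mode i a} \<subseteq> modes n"
      using supp by (auto simp: basis_def)
    moreover have "mode i a \<in> modes n"
      using Cons.prems by (auto simp: modes_def)
    ultimately show "S \<subseteq> modes n" by auto
  next
    fix k assume k: "k < n"
    show "homog n k (if a \<le> k \<and> k < a + length (i # is) then Suc (d k) else d k) (cre_word a (i # is) f)"
    proof (cases "k = a")
      case True
      then show ?thesis
        using homog_cre[of n a "d a" ?g i] hom[of a] Cons.prems k by simp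
    next
      case False
      then have "(a \<le> k \<and> k < a + length (i # is)) = (Suc a \<le> k \<and> k < Suc a + length is)"
        by auto
      then show ?thesis
        using homog_cre_other[OF hom[OF k], of a i] False by simp
    qed
  qed
qed

lemma flattening_support:
  assumes f: "\<And>S. f S \<noteq> 0 \<Longrightarrow> S \<in> basis n d" and "flattening (replicate n n) T f S \<noteq> 0"
  shows "S \<in> basis n (\<lambda>k. Suc (d k))"
proof -
  obtain "is" where "is": "is \<in> tensor_index (replicate n n)" "cre_word 0 is f S \<noteq> 0"
    using assms(2) by (auto simp: flattening_def sum_fock_apply scale_def elim!: sum.not_neutral_contains_not_neutral)
  then have "\<forall>i\<in>set is. i < n" "length is = n"
    by (auto simp: tensor_index_def list_all2_conv_all_nth in_set_conv_nth)
  with cre_word_support[of "is" n 0 f d S] f "is"(2)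
  show ?thesis
    by (auto simp: basis_def)
qed

lemma cre_word_linear: "cre_word a is (\<Sum>S\<in>X. scale (x S) (F S)) = (\<Sum>S\<in>X. scale (x S) (cre_word a is (F S)))"
  by (induction "is" arbitrary: a) (simp_all only: cre_word.simps cre_sum cre_scale)

text \<open>This brings \<open>Phi(T)\<close> into the shape required by
  \<open>zariski_closure_singular\<close>: the matrix entries are linear in the coordinates of
  \<open>T\<close>.\<close>

lemma flattening_matrix:
  assumes "finite X" "\<And>S. f S \<noteq> 0 \<Longrightarrow> S \<in> X"
  shows "flattening ns T f S' =
    (\<Sum>S\<in>X. (\<Sum>is\<in>tensor_index ns. T is * cre_word 0 is (delta S) S') * f S)"
proof -
  have f: "f = (\<Sum>S\<in>X. scale (f S) (delta S))"
  proof
    fix S'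
    have "(\<Sum>S\<in>X. scale (f S) (delta S)) S' = (\<Sum>S\<in>X. if S = S' then f S else 0)"
      unfolding sum_fock_apply by (rule sum.cong) (auto simp: scale_def delta_def)
    then show "f S' = (\<Sum>S\<in>X. scale (f S) (delta S)) S'"
      using assms by auto
  qed
  have word: "cre_word 0 is f S' = (\<Sum>S\<in>X. f S * cre_word 0 is (delta S) S')" for "is"
  proof -
    have "cre_word 0 is f = cre_word 0 is (\<Sum>S\<in>X. scale (f S) (delta S))"
      using f by (rule arg_cong)
    also have "\<dots> = (\<Sum>S\<in>X. scale (f S) (cre_word 0 is (delta S)))"
      by (rule cre_word_linear)
    finally show ?thesis
      by (simp add: sum_fock_apply scale_def)
  qed
  have "flattening ns T f S' = (\<Sum>is\<in>tensor_index ns. \<Sum>S\<in>X. T is * cre_word 0 is (delta S) S' * f S)"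
    by (simp add: flattening_def sum_fock_apply scale_def word sum_distrib_left mult_ac)
  also have "\<dots> = (\<Sum>S\<in>X. \<Sum>is\<in>tensor_index ns. T is * cre_word 0 is (delta S) S' * f S)"
    by (rule sum.swap)
  finally show ?thesis
    by (simp only: sum_distrib_right)
qed

section \<open>The flattened determinant as a polarized top element\<close>

lemma bij_betw_assignments:
  assumes "\<phi> \<in> assignments (Suc l) l l"
  shows "bij_betw \<phi> {..<Suc l} {..<Suc l}"
proof -
  have range: "\<phi> ` {..<Suc l} \<subseteq> {..<Suc l}"
  proof (rule image_subsetI)
    fix i assume "i \<in> {..<Suc l}"
    then have "\<phi> i \<in> insert l {..<l}"
      using assms by (auto simp: assignments_def)
    then show "\<phi> i \<in> {..<Suc l}" by auto
  qed
  have "k \<in> \<phi> ` {..<Suc l}" if "k < Suc l" for k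
  proof (cases "k = l")
    case True
    \<comment> \<open>Exactly \<open>Suc l - l = 1\<close> row keeps the value
      \<open>l\<close>.\<close>
    have "filter (\<lambda>i. \<phi> i = l) [0..<Suc l] \<noteq> []"
      using card_assignments_last(1)[OF assms] by force
    then obtain i where "i \<in> set (filter (\<lambda>i. \<phi> i = l) [0..<Suc l])"
      by (meson list.set_sel(1))
    then show ?thesis
      using True by (auto simp del: upt_Suc)
  next
    case False
    then have "\<exists>!i. i < Suc l \<and> \<phi> i = k"
      using assms that by (auto simp: assignments_def)
    then show ?thesis by blast
  qed
  then have surj: "\<phi> ` {..<Suc l} = {..<Suc l}"
    using range by auto
  then show ?thesis
    by (simp add: bij_betw_def eq_card_imp_inj_on)
qed

text \<open>With \<open>Suc l\<close> rows an assignment uses every column once. It differs from a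
  permutation only off the domain, where one is \<open>undefined\<close> and the other the
  identity.\<close>

lemma sum_assignments_permutes:
  "(\<Sum>\<phi>\<in>assignments (Suc l) l l. row_product [0..<Suc l] \<phi> f) =
   (\<Sum>\<tau> | \<tau> permutes {..<Suc l}. row_product [0..<Suc l] \<tau> f)"
proof (rule sum.reindex_bij_witness[where i = "\<lambda>\<tau>. restrict \<tau> {..<Suc l}"
    and j = "\<lambda>\<phi> i. if i < Suc l then \<phi> i else i"])
  fix \<phi> assume \<phi>: "\<phi> \<in> assignments (Suc l) l l"
  show "(\<lambda>i\<in>{..<Suc l}. if i < Suc l then \<phi> i else i) = \<phi>"
    using \<phi> by (auto simp: assignments_def PiE_iff extensional_def fun_eq_iff)
  have "bij_betw (\<lambda>i. if i < Suc l then \<phi> i else i) {..<Suc l} {..<Suc l}"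
    by (rule bij_betw_cong[THEN iffD1, OF _ bij_betw_assignments[OF \<phi>]]) simp
  then show "(\<lambda>i. if i < Suc l then \<phi> i else i) \<in> {\<tau>. \<tau> permutes {..<Suc l}}"
    unfolding mem_Collect_eq by (rule bij_imp_permutes) simp
  show "row_product [0..<Suc l] (\<lambda>i. if i < Suc l then \<phi> i else i) f = row_product [0..<Suc l] \<phi> f"
    by (rule row_product_cong) auto
next
  fix \<tau> assume "\<tau> \<in> {\<tau>. \<tau> permutes {..<Suc l}}"
  then have \<tau>: "\<tau> permutes {..<Suc l}" by simp
  show "(\<lambda>i. if i < Suc l then restrict \<tau> {..<Suc l} i else i) = \<tau>"
    using permutes_not_in[OF \<tau>] by (auto simp: fun_eq_iff)
  have "\<exists>!i. i < Suc l \<and> restrict \<tau> {..<Suc l} i = k" if "k < l" for k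
  proof (rule ex1I[of _ "Hilbert_Choice.inv \<tau> k"])
    have "Hilbert_Choice.inv \<tau> k < Suc l"
      using permutes_in_image[OF permutes_inv[OF \<tau>], of k] that by simp
    then show "Hilbert_Choice.inv \<tau> k < Suc l \<and> restrict \<tau> {..<Suc l} (Hilbert_Choice.inv \<tau> k) = k"
      using permutes_inverses[OF \<tau>] by simp
  next
    fix i assume "i < Suc l \<and> restrict \<tau> {..<Suc l} i = k"
    then show "i = Hilbert_Choice.inv \<tau> k"
      using permutes_inverses[OF \<tau>] by auto
  qed
  moreover have "restrict \<tau> {..<Suc l} \<in> {..<Suc l} \<rightarrow>\<^sub>E insert l {..<l}"
  proof (rule PiE_I)
    fix i assume i: "i \<in> {..<Suc l}"
    then have "\<tau> i \<in> {..<Suc l}"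
      unfolding permutes_in_image[OF \<tau>] .
    then show "restrict \<tau> {..<Suc l} i \<in> insert l {..<l}"
      using i by (auto simp: less_Suc_eq)
  qed simp
  ultimately show "restrict \<tau> {..<Suc l} \<in> assignments (Suc l) l l"
    by (auto simp: assignments_def)
qed

lemma foldr_cre_eq_cre_word:
  "foldr cre (map (\<lambda>k. mode (\<sigma> k) k) [a..<b]) f = cre_word a (map \<sigma> [a..<b]) f"
proof (cases "a \<le> b")
  case True
  then show ?thesis
    by (induction a rule: inc_induct) (simp_all add: upt_conv_Cons)
qed simp

text \<open>Reordering the creators from row order to column order contributes
  \<open>sign \<tau>\<close> and lists the rows by the inverse of \<open>\<tau>\<close>; summing
  over inverses gives the determinant.\<close>

lemma polarized_top_eq_flattening_det:
  "polarized_top (Suc l) l l f = flattening (replicate (Suc l) (Suc l)) (det_tensor (Suc l) :: 'a::field tensor) f"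
proof -
  let ?n = "Suc l"
  have "row_product [0..<?n] \<tau> f = scale (of_int (sign \<tau>)) (cre_word 0 (map (Hilbert_Choice.inv \<tau>) [0..<?n]) f)"
    if \<tau>: "\<tau> permutes {..<?n}" for \<tau>
  proof -
    have "row_product [0..<?n] \<tau> f = foldr cre (map (\<lambda>i. mode i (\<tau> i)) [0..<?n]) f"
      unfolding row_product_def by (simp only: foldr_map comp_def)
    also have "(\<lambda>i. mode i (\<tau> i)) = (\<lambda>k. mode (Hilbert_Choice.inv \<tau> k) k) \<circ> \<tau>"
      using permutes_inverses[OF \<tau>] by (auto simp: fun_eq_iff)
    also have "foldr cre (map ((\<lambda>k. mode (Hilbert_Choice.inv \<tau> k) k) \<circ> \<tau>) [0..<?n]) f =
        scale (of_int (sign \<tau>)) (cre_word 0 (map (Hilbert_Choice.inv \<tau>) [0..<?n]) f)"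
      unfolding foldr_cre_permute[OF \<tau>] foldr_cre_eq_cre_word ..
    finally show ?thesis .
  qed
  then have "polarized_top ?n l l f =
      (\<Sum>\<tau> | \<tau> permutes {..<?n}. scale (of_int (sign \<tau>)) (cre_word 0 (map (Hilbert_Choice.inv \<tau>) [0..<?n]) f))"
    unfolding polarized_top_def sum_assignments_permutes by (intro sum.cong) auto
  also have "\<dots> = (\<Sum>\<tau> | \<tau> permutes {..<?n}. scale (of_int (sign (Hilbert_Choice.inv \<tau>))) (cre_word 0 (map (Hilbert_Choice.inv (Hilbert_Choice.inv \<tau>)) [0..<?n]) f))"
    by (rule sum_permutations_inverse)
  also have "\<dots> = (\<Sum>\<tau> | \<tau> permutes {..<?n}. scale (of_int (sign \<tau>)) (cre_word 0 (map \<tau> [0..<?n]) f))"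
    by (intro sum.cong) (auto simp: sign_inverse permutes_inv_inv permutes_imp_permutation[OF finite_lessThan])
  finally show ?thesis
    unfolding flattening_det .
qed

lemma flattening_det_inj:
  fixes f :: "'a::field_char_0 fock"
  assumes "n \<ge> 1" "\<And>k. k < n \<Longrightarrow> homog n k k f"
    and "flattening (replicate n n) (det_tensor n) f = 0"
  shows "f = 0"
proof -
  obtain l where n: "n = Suc l"
    using assms(1) by (cases n) auto
  show ?thesis
    by (rule polarized_top_inj[of l l n f]) (use assms n polarized_top_eq_flattening_det[of l f] in auto)
qed

section \<open>A kernel for sums of few pure tensors\<close>

lemma cre_vecs_eq_0:
  assumes "\<exists>v\<in>set vs. \<forall>i<dim_vec v. v $ i = 0"
  shows "cre_vecs a vs f = 0"
  using assms
proof (induction vs arbitrary: a)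
  case (Cons v vs)
  show ?case
  proof (cases "\<forall>i<dim_vec v. v $ i = 0")
    case True
    then show ?thesis by (simp add: cre_vec_def)
  next
    case False
    then have "\<exists>u\<in>set vs. \<forall>i<dim_vec u. u $ i = 0"
      using Cons.prems by auto
    then show ?thesis by (simp add: Cons.IH)
  qed
qed simp

text \<open>Each pure summand is killed once its pivot coordinates vanish. These are fewer linear
  conditions in total than the dimension of the source, so a non-zero \<open>f\<close> satisfies
  them all.\<close>

lemma flattening_kernel:
  fixes v :: "nat \<Rightarrow> 'a::field_char_0 vec list"
  assumes v: "\<And>i. i < r \<Longrightarrow> list_all2 (\<lambda>u m. u \<in> carrier_vec m) (v i) (replicate n n)"
    and less: "r * (\<Prod>k<n. (n - 1) choose k) < (\<Prod>k<n. n choose k)"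
  shows "\<exists>f. f \<noteq> 0 \<and> (\<forall>S. f S \<noteq> 0 \<longrightarrow> S \<in> basis n (\<lambda>k. k)) \<and>
    flattening (replicate n n) (\<lambda>is. \<Sum>i<r. pure_tensor (v i) is) f = 0"
proof -
  let ?X = "basis n (\<lambda>k. k)" and ?ns = "replicate n n"
  have len: "length (v i) = n" and dim: "map dim_vec (v i) = ?ns" if "i < r" for i
    using v[OF that] by (auto simp: list_all2_conv_all_nth intro!: nth_equalityI)
  \<comment> \<open>A summand with a zero factor flattens to 0, so conditions are imposed only for
    the other summands.\<close>
  define good where "good i \<longleftrightarrow> (\<forall>k<n. \<exists>p<n. (v i ! k) $ p \<noteq> 0)" for i
  define p where "p i k = (SOME p. p < n \<and> (v i ! k) $ p \<noteq> 0)" for i k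
  have p: "p i k < n" "(v i ! k) $ p i k \<noteq> 0" if "good i" "k < n" for i k
    using that someI_ex[of "\<lambda>p. p < n \<and> (v i ! k) $ p \<noteq> 0"] by (auto simp: good_def p_def)
  define E where "E i = (if good i then {S \<in> basis n Suc. \<forall>k<n. mode (p i k) k \<in> S} else {})" for i
  define M where "M = (\<lambda>(i, S') S. \<Sum>is\<in>tensor_index ?ns. pure_tensor (v i) is * cre_word 0 is (delta S) S')"
  have fin: "finite (E i)" for i
    by (auto simp: E_def)
  have "card (Sigma {..<r} E) = (\<Sum>i<r. card (E i))"
    using fin by simp
  also have "\<dots> \<le> (\<Sum>i<r. \<Prod>k<n. (n - 1) choose k)"
    by (rule sum_mono) (auto simp: E_def p card_basis_pivots)
  also have "\<dots> = r * (\<Prod>k<n. (n - 1) choose k)"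
    by simp
  also have "\<dots> < card ?X"
    using less by (simp add: card_basis)
  finally obtain x where x: "\<exists>S\<in>?X. x S \<noteq> 0" "\<And>b. b \<in> Sigma {..<r} E \<Longrightarrow> (\<Sum>S\<in>?X. M b S * x S) = 0"
    using underdetermined_system[of ?X "Sigma {..<r} E" M] fin by auto
  define f where "f S = (if S \<in> ?X then x S else 0)" for S
  have supp: "S \<in> ?X" if "f S \<noteq> 0" for S
    using that by (auto simp: f_def split: if_splits)
  have zero: "flattening ?ns (pure_tensor (v i)) f S' = 0" if "i < r" "S' \<in> E i" for i S'
  proof -
    have "flattening ?ns (pure_tensor (v i)) f S' = (\<Sum>S\<in>?X. M (i, S') S * f S)"
      unfolding M_def prod.case by (rule flattening_matrix) (use supp in auto)
    also have "\<dots> = (\<Sum>S\<in>?X. M (i, S') S * x S)"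
      by (rule sum.cong) (auto simp: f_def)
    finally show ?thesis
      using x(2)[of "(i, S')"] that by simp
  qed
  have pure: "flattening ?ns (pure_tensor (v i)) f = 0" if i: "i < r" for i
  proof (cases "good i")
    case True
    show ?thesis
    proof (rule pivots_determine[where m = n and v = "\<lambda>k. v i ! k" and p = "p i"])
      fix k assume k: "k < n"
      show "cre_vec (v i ! k) k (flattening ?ns (pure_tensor (v i)) f) = 0"
        using cre_vec_cre_vecs[of k "v i" 0 f] k len[OF i] unfolding flattening_pure[OF dim[OF i]] by simp
      show "p i k < dim_vec (v i ! k)"
        using p(1)[OF True k] v[OF i] k by (auto simp: list_all2_conv_all_nth)
      show "v i ! k $ p i k \<noteq> 0"
        by (rule p(2)[OF True k])
    next
      fix S assume S: "\<And>k. k < n \<Longrightarrow> mode (p i k) k \<in> S"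
      show "flattening ?ns (pure_tensor (v i)) f S = 0"
      proof (rule ccontr)
        assume nz: "flattening ?ns (pure_tensor (v i)) f S \<noteq> 0"
        have "S \<in> basis n Suc"
          by (rule flattening_support[OF supp nz])
        then have "S \<in> E i"
          using S True by (simp add: E_def)
        then show False
          using zero[OF i] nz by blast
      qed
    qed
  next
    case False
    then obtain k where "k < n" "\<forall>q<n. (v i ! k) $ q = 0"
      by (auto simp: good_def)
    then have "\<exists>u\<in>set (v i). \<forall>q<dim_vec u. u $ q = 0"
      using v[OF i] by (intro bexI[of _ "v i ! k"]) (auto simp: list_all2_conv_all_nth)
    then show ?thesis
      unfolding flattening_pure[OF dim[OF i]] by (rule cre_vecs_eq_0)
  qed
  have "flattening ?ns (\<lambda>is. \<Sum>i<r. 1 * pure_tensor (v i) is) f = 0"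
    unfolding flattening_sum by (rule sum.neutral) (auto simp: pure)
  moreover have "f \<noteq> 0"
    using x(1) by (auto simp: f_def fun_eq_iff zero_fun_apply)
  ultimately show ?thesis
    using supp by auto
qed

section \<open>From tensor rank to border rank\<close>

lemma tensor_rank_decomposition:
  fixes T :: "'a::field tensor"
  assumes "T \<in> tensor_space ns" "ns \<noteq> []"
  shows "\<exists>v :: nat \<Rightarrow> 'a vec list.
    (\<forall>i<tensor_rank ns T. list_all2 (\<lambda>u m. u \<in> carrier_vec m) (v i) ns) \<and>
    T = (\<lambda>is. \<Sum>i<tensor_rank ns T. pure_tensor (v i) is)"
  unfolding tensor_rank_def
  by (rule LeastI_ex) (rule tensor_decomposition_exists[OF assms])

text \<open>Otherwise \<open>Phi\<close> would be singular on all tensors of rank at most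
  \<open>r\<close>, hence on the closure and at the determinant, against
  \<open>flattening_det_inj\<close>.\<close>

lemma det_in_closure_bound:
  assumes "n \<ge> 1"
    and closure: "(det_tensor n :: 'a::field_char_0 tensor) \<in>
      zariski_closure (replicate n n) {S \<in> tensor_space (replicate n n). tensor_rank (replicate n n) S \<le> r}"
  shows "(\<Prod>k<n. n choose k) \<le> r * (\<Prod>k<n. (n - 1) choose k)"
proof (rule ccontr)
  assume "\<not> ?thesis"
  then have less: "r * (\<Prod>k<n. (n - 1) choose k) < (\<Prod>k<n. n choose k)" by simp
  let ?X = "basis n (\<lambda>k. k)" and ?Y = "basis n Suc" and ?ns = "replicate n n"
  let ?A = "{S \<in> tensor_space ?ns. tensor_rank ?ns S \<le> r} :: 'a tensor set"
  let ?M = "\<lambda>T S' S. \<Sum>is\<in>tensor_index ?ns. T is * (cre_word 0 is (delta S) S' :: 'a)"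
  have "\<exists>x. (\<exists>S\<in>?X. x S \<noteq> 0) \<and> (\<forall>S'\<in>?Y. (\<Sum>S\<in>?X. ?M (det_tensor n) S' S * x S) = 0)"
  proof (rule zariski_closure_singular[OF _ _ _ _ _ closure])
    fix T assume T: "T \<in> ?A"
    let ?r = "tensor_rank ?ns T"
    obtain v :: "nat \<Rightarrow> 'a vec list"
      where v: "\<And>i. i < ?r \<Longrightarrow> list_all2 (\<lambda>u m. u \<in> carrier_vec m) (v i) ?ns"
        and Tv: "T = (\<lambda>is. \<Sum>i<?r. pure_tensor (v i) is)"
      using tensor_rank_decomposition[of T ?ns] T \<open>n \<ge> 1\<close> by auto
    have "?r * (\<Prod>k<n. (n - 1) choose k) \<le> r * (\<Prod>k<n. (n - 1) choose k)"
      using T by (intro mult_right_mono) auto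
    with less have less': "?r * (\<Prod>k<n. (n - 1) choose k) < (\<Prod>k<n. n choose k)"
      by linarith
    have "\<exists>f. f \<noteq> 0 \<and> (\<forall>S. f S \<noteq> 0 \<longrightarrow> S \<in> ?X) \<and>
      flattening ?ns (\<lambda>is. \<Sum>i<?r. pure_tensor (v i) is) f = 0"
      by (rule flattening_kernel[OF v less'])
    then obtain f where f0: "f \<noteq> 0 \<and> (\<forall>S. f S \<noteq> 0 \<longrightarrow> S \<in> ?X) \<and>
      flattening ?ns (\<lambda>is. \<Sum>i<?r. pure_tensor (v i) is) f = 0"
      by (elim exE)
    then have f: "f \<noteq> 0" "\<And>S. f S \<noteq> 0 \<Longrightarrow> S \<in> ?X"
      by auto
    have f3: "flattening ?ns T f = 0"
      by (subst Tv) (use f0 in simp)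
    have "\<exists>S\<in>?X. f S \<noteq> 0"
      using f(1,2) by (auto simp: fun_eq_iff zero_fun_apply)
    moreover have "(\<Sum>S\<in>?X. ?M T S' S * f S) = 0" for S'
      using flattening_matrix[of ?X f ?ns T S'] f(2) f3 by (simp add: zero_fun_apply)
    ultimately show "\<exists>x. (\<exists>S\<in>?X. x S \<noteq> 0) \<and> (\<forall>S'\<in>?Y. (\<Sum>S\<in>?X. ?M T S' S * x S) = 0)"
      by blast
  qed (auto simp: card_basis_shift)
  then obtain x where x: "\<exists>S\<in>?X. x S \<noteq> 0" "\<And>S'. S' \<in> ?Y \<Longrightarrow> (\<Sum>S\<in>?X. ?M (det_tensor n) S' S * x S) = 0"
    by blast
  define f where "f S = (if S \<in> ?X then x S else 0)" for S
  have supp: "S \<in> ?X" if "f S \<noteq> 0" for S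
    using that by (auto simp: f_def split: if_splits)
  have flat: "flattening ?ns (det_tensor n) f = 0"
  proof
    fix S'
    show "flattening ?ns (det_tensor n) f S' = 0 S'"
    proof (cases "S' \<in> ?Y")
      case True
      have "flattening ?ns (det_tensor n) f S' = (\<Sum>S\<in>?X. ?M (det_tensor n) S' S * f S)"
        by (rule flattening_matrix) (use supp in auto)
      also have "\<dots> = (\<Sum>S\<in>?X. ?M (det_tensor n) S' S * x S)"
        by (rule sum.cong) (auto simp: f_def)
      finally show ?thesis
        using x(2)[OF True] by (simp add: zero_fun_apply)
    next
      case False
      then show ?thesis
        using flattening_support[where T = "det_tensor n" and S = S', OF supp] by (auto simp: zero_fun_apply)
    qed
  qed
  have hom: "homog n k k f" if "k < n" for k
    using homog_basis[where f = f and d = "\<lambda>k. k", OF supp that] by simp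
  have "f = 0"
    by (rule flattening_det_inj[OF \<open>n \<ge> 1\<close> hom flat])
  obtain S where "S \<in> ?X" "x S \<noteq> 0"
    using x(1) by blast
  then have "f S \<noteq> 0"
    by (simp add: f_def)
  with \<open>f = 0\<close> show False
    by (simp add: zero_fun_apply)
qed

lemma zariski_closure_superset: "S \<subseteq> zariski_closure ns S"
  by (auto simp: zariski_closure_def)

theorem theorem4p2:
  fixes n :: nat
  assumes "n \<ge> 1"
  shows "real (border_rank (replicate n n) (det_tensor n :: 'a::field_char_0 tensor))
           \<ge> real n ^ (n - 1) / fact (n - 1)"
proof -
  let ?T = "det_tensor n :: 'a tensor" and ?ns = "replicate n n"
  define r where "r = border_rank ?ns ?T"
  define b where "b = (\<Prod>k<n. (n - 1) choose k)"
  have "?T \<in> zariski_closure ?ns {S \<in> tensor_space ?ns. tensor_rank ?ns S \<le> r}"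
    unfolding r_def border_rank_def
  \<comment> \<open>The minimum is attained because the tensor rank of the determinant is an
    admissible value.\<close>
  proof (rule LeastI_ex, rule exI)
    show "?T \<in> zariski_closure ?ns {S \<in> tensor_space ?ns. tensor_rank ?ns S \<le> tensor_rank ?ns ?T}"
      by (rule subsetD[OF zariski_closure_superset]) (simp add: det_tensor_in_tensor_space)
  qed
  then have "(\<Prod>k<n. n choose k) \<le> r * b"
    unfolding b_def by (rule det_in_closure_bound[OF assms])
  then have "n ^ n * b \<le> (r * fact n) * b"
    using prod_binomial_ratio[of n] mult_right_mono[of _ _ "fact n :: nat"]
    unfolding b_def by (metis le0 mult.assoc mult.commute)
  moreover have "b > 0"
    unfolding b_def by (rule prod_pos) auto
  ultimately have "n ^ n \<le> r * fact n"
    by simp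
  \<comment> \<open>Since \<open>fact n = n * fact (n - 1)\<close>, a factor \<open>n\<close> splits
    off on both sides and cancels.\<close>
  then have "n * n ^ (n - 1) \<le> n * (r * fact (n - 1))"
    using assms by (cases n) (auto simp: algebra_simps)
  then have "n ^ (n - 1) \<le> r * fact (n - 1)"
    using assms by simp
  then have "real (n ^ (n - 1)) \<le> real (r * fact (n - 1))"
    by (rule of_nat_mono)
  then show ?thesis
    by (simp add: r_def[symmetric] divide_le_eq)
qed

end
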